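(* Let $G$ be a Følner amenable Polish group admitting a uniformly continuous coarse embedding into a Banach space $E$. Then, for every $1\leqslant p<\infty$, $G$ admits a coarsely proper continuous affine isometric action on a Banach space $V$ that is finitely representable in $L^p(E)$.
   Context: A Polish group is a separable completely metrisable topological group. A Polish group $G$ is Følner amenable if either (1) there is a countable chain $K_0\leqslant K_1\leqslant\cdots\leqslant G$ of compact subgroups whose union is dense in $G$, or (2) there is a continuous homomorphism $\phi\colon H\to G$ with dense image from a locally compact second countable amenable group $H$. An écart is a pseudometric. The left-coarse structure $\mathcal E_L$ of a topological group $G$ is the family of all $A\subseteq G\times G$ such that $\sup_{(x,y)\in A}d(x,y)<\infty$ for every continuous left-invariant écart $d$ on $G$. A map $\sigma\colon G\to (Y,\partial)$ into a metric space is bornologous if $\sup_{(x,y)\in A}\partial(\sigma(x),\sigma(y))<\infty$ for every $A\in\mathcal E_L$; expanding if for every $C<\infty$ the set $\{(x,y): \partial(\sigma(x),\sigma(y))\leqslant C\}$ belongs to $\mathcal E_L$; a coarse embedding if it is bornologous and expanding. It is uniformly continuous if it is so for the left-uniform structure: for every $\epsilon>0$ there is an identity neighbourhood $V\subseteq G$ such that $x^{-1}y\in V$ implies $\partial(\sigma(x),\sigma(y))<\epsilon$. A continuous affine isometric action of $G$ on a Banach space $V$ has the form $\alpha(g)\xi=\pi(g)\xi+b(g)$, where $\pi$ is a strongly continuous isometric linear representation of $G$ on $V$ and $b\colon G\to V$ is continuous with $b(gf)=\pi(g)b(f)+b(g)$; it is coarsely proper if $b$ is a coarse embedding. A Banach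 space $V$ is finitely representable in a Banach space $Y$ if for every finite-dimensional subspace $F\subseteq V$ and $\epsilon>0$ there is a linear embedding $T\colon F\to Y$ with $\|T\|\cdot\|T^{-1}\|<1+\epsilon$. $L^p(E)$ is the Banach space of (classes of) measurable $f\colon[0,1]\to E$ with $\|f\|=(\int_0^1\|f\|_E^p\,d\lambda)^{1/p}<\infty$. *)

theory Defs
  imports "HOL-Analysis.Analysis" "HOL-Algebra.Module"
begin

section \<open>Topological groups\<close>

definition topological_group :: "'g monoid \<Rightarrow> 'g topology \<Rightarrow> bool" where
  "topological_group G T \<longleftrightarrow>
     group G \<and> topspace T = carrier G \<and>
     continuous_map (prod_topology T T) T (\<lambda>(x, y). x \<otimes>\<^bsub>G\<^esub> y) \<and>
     continuous_map T T (\<lambda>x. inv\<^bsub>G\<^esub> x)"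

definition polish_group :: "'g monoid \<Rightarrow> 'g topology \<Rightarrow> bool" where
  "polish_group G T \<longleftrightarrow>
     topological_group G T \<and> separable_space T \<and> completely_metrizable_space T"

text \<open>Maps into a metric space are given together with the distance function of the target,
  so that the same notions apply to a Banach space that is a type and to one that is a
  structure with a carrier.\<close>

definition left_uniformly_continuous ::
  "'g monoid \<Rightarrow> 'g topology \<Rightarrow> ('y \<Rightarrow> 'y \<Rightarrow> real) \<Rightarrow> ('g \<Rightarrow> 'y) \<Rightarrow> bool" where
  "left_uniformly_continuous G T D \<sigma> \<longleftrightarrow>
     (\<forall>\<epsilon>>0. \<exists>U. openin T U \<and> \<one>\<^bsub>G\<^esub> \<in> U \<and>
        (\<forall>x\<in>carrier G. \<forall>y\<in>carrier G. inv\<^bsub>G\<^esub> x \<otimes>\<^bsub>G\<^esub> y \<in> U \<longrightarrow> D (\<sigma> x) (\<sigma> y) < \<epsilon>))"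


section \<open>Amenability\<close>

text \<open>Amenability is the existence of an invariant mean on the bounded real functions that are
  uniformly continuous for the left-uniform structure (\<open>x\<inverse>y\<close> small). On this space the right
  translations \<open>f \<mapsto> f(\<cdot> g)\<close> act norm-continuously, and these are the ones under which the mean
  is invariant. Precomposing with inversion yields the equivalent form with left translations
  and the right-uniform structure. The values of \<open>f\<close> outside the carrier are irrelevant, by
  linearity and positivity of the mean.\<close>

definition bounded_left_uniform :: "'g monoid \<Rightarrow> 'g topology \<Rightarrow> ('g \<Rightarrow> real) set" where
  "bounded_left_uniform G T =
     {f. bounded (f ` carrier G) \<and> left_uniformly_continuous G T dist f}"

definition invariant_mean :: "'g monoid \<Rightarrow> 'g topology \<Rightarrow> (('g \<Rightarrow> real) \<Rightarrow> real) \<Rightarrow> bool" where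
  "invariant_mean G T m \<longleftrightarrow>
     (\<forall>f\<in>bounded_left_uniform G T. \<forall>h\<in>bounded_left_uniform G T.
        m (\<lambda>x. f x + h x) = m f + m h) \<and>
     (\<forall>c. \<forall>f\<in>bounded_left_uniform G T. m (\<lambda>x. c * f x) = c * m f) \<and>
     (\<forall>f\<in>bounded_left_uniform G T. (\<forall>x\<in>carrier G. 0 \<le> f x) \<longrightarrow> 0 \<le> m f) \<and>
     m (\<lambda>x. 1) = 1 \<and>
     (\<forall>g\<in>carrier G. \<forall>f\<in>bounded_left_uniform G T. m (\<lambda>x. f (x \<otimes>\<^bsub>G\<^esub> g)) = m f)"

definition amenable :: "'g monoid \<Rightarrow> 'g topology \<Rightarrow> bool" where
  "amenable G T \<longleftrightarrow> (\<exists>m. invariant_mean G T m)"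

definition compact_chain_dense :: "'g monoid \<Rightarrow> 'g topology \<Rightarrow> bool" where
  "compact_chain_dense G T \<longleftrightarrow>
     (\<exists>K :: nat \<Rightarrow> 'g set.
        (\<forall>n. subgroup (K n) G \<and> compactin T (K n) \<and> K n \<subseteq> K (Suc n)) \<and>
        T closure_of (\<Union>n. K n) = carrier G)"

definition dense_image_of_amenable ::
  "'h monoid \<Rightarrow> 'h topology \<Rightarrow> 'g monoid \<Rightarrow> 'g topology \<Rightarrow> bool" where
  "dense_image_of_amenable H S G T \<longleftrightarrow>
     topological_group H S \<and> Hausdorff_space S \<and> locally_compact_space S \<and>
     second_countable S \<and> amenable H S \<and>
     (\<exists>\<phi>\<in>hom H G. continuous_map S T \<phi> \<and> T closure_of (\<phi> ` carrier H) = carrier G)"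

text \<open>HOL cannot quantify over the type carrying \<open>H\<close> inside a formula, so that type is an
  argument. In a theorem that assumes Folner amenability and leaves \<open>'h\<close> free, \<open>H\<close> ranges over
  groups of every type.\<close>

definition folner_amenable :: "'h itself \<Rightarrow> 'g monoid \<Rightarrow> 'g topology \<Rightarrow> bool" where
  "folner_amenable H_type G T \<longleftrightarrow>
     compact_chain_dense G T \<or>
     (\<exists>(H :: 'h monoid) S. dense_image_of_amenable H S G T)"


section \<open>The left-coarse structure\<close>

definition ecart_on :: "'a set \<Rightarrow> ('a \<Rightarrow> 'a \<Rightarrow> real) \<Rightarrow> bool" where
  "ecart_on X d \<longleftrightarrow>
     (\<forall>x\<in>X. d x x = 0) \<and>
     (\<forall>x\<in>X. \<forall>y\<in>X. 0 \<le> d x y \<and> d x y = d y x) \<and>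
     (\<forall>x\<in>X. \<forall>y\<in>X. \<forall>z\<in>X. d x z \<le> d x y + d y z)"

definition continuous_left_invariant_ecart ::
  "'g monoid \<Rightarrow> 'g topology \<Rightarrow> ('g \<Rightarrow> 'g \<Rightarrow> real) \<Rightarrow> bool" where
  "continuous_left_invariant_ecart G T d \<longleftrightarrow>
     ecart_on (carrier G) d \<and>
     continuous_map (prod_topology T T) euclideanreal (\<lambda>(x, y). d x y) \<and>
     (\<forall>g\<in>carrier G. \<forall>x\<in>carrier G. \<forall>y\<in>carrier G. d (g \<otimes>\<^bsub>G\<^esub> x) (g \<otimes>\<^bsub>G\<^esub> y) = d x y)"

definition left_coarse :: "'g monoid \<Rightarrow> 'g topology \<Rightarrow> ('g \<times> 'g) set set" where
  "left_coarse G T =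
     {A. A \<subseteq> carrier G \<times> carrier G \<and>
         (\<forall>d. continuous_left_invariant_ecart G T d \<longrightarrow> bdd_above ((\<lambda>(x, y). d x y) ` A))}"

definition bornologous ::
  "'g monoid \<Rightarrow> 'g topology \<Rightarrow> ('y \<Rightarrow> 'y \<Rightarrow> real) \<Rightarrow> ('g \<Rightarrow> 'y) \<Rightarrow> bool" where
  "bornologous G T D \<sigma> \<longleftrightarrow>
     (\<forall>A\<in>left_coarse G T. bdd_above ((\<lambda>(x, y). D (\<sigma> x) (\<sigma> y)) ` A))"

definition expanding ::
  "'g monoid \<Rightarrow> 'g topology \<Rightarrow> ('y \<Rightarrow> 'y \<Rightarrow> real) \<Rightarrow> ('g \<Rightarrow> 'y) \<Rightarrow> bool" where
  "expanding G T D \<sigma> \<longleftrightarrow>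
     (\<forall>C. {(x, y). x \<in> carrier G \<and> y \<in> carrier G \<and> D (\<sigma> x) (\<sigma> y) \<le> C} \<in> left_coarse G T)"

definition coarse_embedding ::
  "'g monoid \<Rightarrow> 'g topology \<Rightarrow> ('y \<Rightarrow> 'y \<Rightarrow> real) \<Rightarrow> ('g \<Rightarrow> 'y) \<Rightarrow> bool" where
  "coarse_embedding G T D \<sigma> \<longleftrightarrow> bornologous G T D \<sigma> \<and> expanding G T D \<sigma>"


section \<open>Real Banach spaces with an explicit carrier\<close>

definition real_ring :: "real ring" where
  "real_ring = \<lparr>carrier = UNIV, mult = (*), one = 1, zero = 0, add = (+)\<rparr>"

text \<open>The fields \<open>mult\<close> and \<open>one\<close> that the record inherits from rings play no role.
  An existence claim for a Banach space must name a type for its elements. For a space that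
  carries a continuous cocycle on a separable group, a type with at least continuum many elements
  is no restriction: the space can be replaced by the closed linear span of the range of the
  cocycle, which is separable and invariant.\<close>

record 'v normed_module = "(real, 'v) module" +
  vnorm :: "'v \<Rightarrow> real"

text \<open>The value \<open>0\<close> off the carrier serves the locale \<^locale>\<open>Metric_space\<close>, whose
  nonnegativity and symmetry axioms are not relativised to the carrier.\<close>

definition vdist :: "'v normed_module \<Rightarrow> 'v \<Rightarrow> 'v \<Rightarrow> real" where
  "vdist V x y = (if x \<in> carrier V \<and> y \<in> carrier V then vnorm V (x \<ominus>\<^bsub>V\<^esub> y) else 0)"

definition normed_space :: "'v normed_module \<Rightarrow> bool" where
  "normed_space V \<longleftrightarrow>
     module real_ring V \<and>
     (\<forall>x\<in>carrier V. 0 \<le> vnorm V x \<and> (vnorm V x = 0 \<longleftrightarrow> x = \<zero>\<^bsub>V\<^esub>)) \<and>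
     (\<forall>c. \<forall>x\<in>carrier V. vnorm V (c \<odot>\<^bsub>V\<^esub> x) = \<bar>c\<bar> * vnorm V x) \<and>
     (\<forall>x\<in>carrier V. \<forall>y\<in>carrier V. vnorm V (x \<oplus>\<^bsub>V\<^esub> y) \<le> vnorm V x + vnorm V y)"

definition banach_space :: "'v normed_module \<Rightarrow> bool" where
  "banach_space V \<longleftrightarrow> normed_space V \<and> Metric_space.mcomplete (carrier V) (vdist V)"

definition norm_topology :: "'v normed_module \<Rightarrow> 'v topology" where
  "norm_topology V = Metric_space.mtopology (carrier V) (vdist V)"

definition linear_map_on ::
  "'v set \<Rightarrow> 'v normed_module \<Rightarrow> 'w normed_module \<Rightarrow> ('v \<Rightarrow> 'w) \<Rightarrow> bool" where
  "linear_map_on F V W f \<longleftrightarrow>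
     f \<in> F \<rightarrow> carrier W \<and>
     (\<forall>x\<in>F. \<forall>y\<in>F. f (x \<oplus>\<^bsub>V\<^esub> y) = f x \<oplus>\<^bsub>W\<^esub> f y) \<and>
     (\<forall>c. \<forall>x\<in>F. f (c \<odot>\<^bsub>V\<^esub> x) = c \<odot>\<^bsub>W\<^esub> f x)"


section \<open>Affine isometric actions\<close>

definition isometric_representation ::
  "'g monoid \<Rightarrow> 'v normed_module \<Rightarrow> ('g \<Rightarrow> 'v \<Rightarrow> 'v) \<Rightarrow> bool" where
  "isometric_representation G V \<pi> \<longleftrightarrow>
     (\<forall>g\<in>carrier G. linear_map_on (carrier V) V V (\<pi> g) \<and>
        (\<forall>\<xi>\<in>carrier V. vnorm V (\<pi> g \<xi>) = vnorm V \<xi>)) \<and>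
     (\<forall>\<xi>\<in>carrier V. \<pi> \<one>\<^bsub>G\<^esub> \<xi> = \<xi>) \<and>
     (\<forall>g\<in>carrier G. \<forall>f\<in>carrier G. \<forall>\<xi>\<in>carrier V. \<pi> (g \<otimes>\<^bsub>G\<^esub> f) \<xi> = \<pi> g (\<pi> f \<xi>))"

definition strongly_continuous ::
  "'g topology \<Rightarrow> 'v normed_module \<Rightarrow> ('g \<Rightarrow> 'v \<Rightarrow> 'v) \<Rightarrow> bool" where
  "strongly_continuous T V \<pi> \<longleftrightarrow>
     (\<forall>\<xi>\<in>carrier V. continuous_map T (norm_topology V) (\<lambda>g. \<pi> g \<xi>))"

definition cocycle ::
  "'g monoid \<Rightarrow> 'v normed_module \<Rightarrow> ('g \<Rightarrow> 'v \<Rightarrow> 'v) \<Rightarrow> ('g \<Rightarrow> 'v) \<Rightarrow> bool" where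
  "cocycle G V \<pi> b \<longleftrightarrow>
     b \<in> carrier G \<rightarrow> carrier V \<and>
     (\<forall>g\<in>carrier G. \<forall>f\<in>carrier G. b (g \<otimes>\<^bsub>G\<^esub> f) = \<pi> g (b f) \<oplus>\<^bsub>V\<^esub> b g)"

definition continuous_affine_isometric_action ::
  "'g monoid \<Rightarrow> 'g topology \<Rightarrow> 'v normed_module \<Rightarrow>
   ('g \<Rightarrow> 'v \<Rightarrow> 'v) \<Rightarrow> ('g \<Rightarrow> 'v \<Rightarrow> 'v) \<Rightarrow> ('g \<Rightarrow> 'v) \<Rightarrow> bool" where
  "continuous_affine_isometric_action G T V \<alpha> \<pi> b \<longleftrightarrow>
     isometric_representation G V \<pi> \<and> strongly_continuous T V \<pi> \<and>
     cocycle G V \<pi> b \<and> continuous_map T (norm_topology V) b \<and>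
     (\<forall>g\<in>carrier G. \<forall>\<xi>\<in>carrier V. \<alpha> g \<xi> = \<pi> g \<xi> \<oplus>\<^bsub>V\<^esub> b g)"

definition coarsely_proper ::
  "'g monoid \<Rightarrow> 'g topology \<Rightarrow> 'v normed_module \<Rightarrow> ('g \<Rightarrow> 'v) \<Rightarrow> bool" where
  "coarsely_proper G T V b \<longleftrightarrow> coarse_embedding G T (vdist V) b"


section \<open>Finite representability\<close>

definition finite_dim_subspace :: "'v set \<Rightarrow> 'v normed_module \<Rightarrow> bool" where
  "finite_dim_subspace F V \<longleftrightarrow>
     submodule F real_ring V \<and>
     (\<exists>B. finite B \<and> B \<subseteq> F \<and> (\<forall>W. submodule W real_ring V \<and> B \<subseteq> W \<longrightarrow> F \<subseteq> W))"

text \<open>The supremum is that of a bounded set in every use below, since linear maps on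
  finite-dimensional normed spaces are bounded.\<close>

definition operator_norm ::
  "'v set \<Rightarrow> 'v normed_module \<Rightarrow> 'w normed_module \<Rightarrow> ('v \<Rightarrow> 'w) \<Rightarrow> real" where
  "operator_norm F V W f = (SUP x\<in>{x \<in> F. vnorm V x \<le> 1}. vnorm W (f x))"

definition finitely_representable :: "'v normed_module \<Rightarrow> 'w normed_module \<Rightarrow> bool" where
  "finitely_representable V Y \<longleftrightarrow>
     (\<forall>F \<epsilon>. finite_dim_subspace F V \<and> 0 < \<epsilon> \<longrightarrow>
        (\<exists>f. linear_map_on F V Y f \<and> inj_on f F \<and>
             operator_norm F V Y f * operator_norm (f ` F) Y V (inv_into F f) < 1 + \<epsilon>))"


section \<open>The Lebesgue-Bochner spaces over the unit interval\<close>

abbreviation unit_lebesgue :: "real measure" where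
  "unit_lebesgue \<equiv> lebesgue_on {0..1}"

text \<open>Measurability is strong (Bochner) measurability: no separability of the Banach space is
  assumed, and Borel measurable functions into a nonseparable space need not be closed under
  addition.\<close>

definition strongly_measurable :: "'a measure \<Rightarrow> ('a \<Rightarrow> 'e::banach) \<Rightarrow> bool" where
  "strongly_measurable M f \<longleftrightarrow>
     (\<exists>s. (\<forall>n::nat. simple_function M (s n)) \<and> (AE x in M. (\<lambda>n. s n x) \<longlonglongrightarrow> f x))"

definition Lp_functions :: "real \<Rightarrow> (real \<Rightarrow> 'e::banach) set" where
  "Lp_functions p =
     {f. strongly_measurable unit_lebesgue f \<and>
         integrable unit_lebesgue (\<lambda>x. norm (f x) powr p)}"

definition ae_class :: "(real \<Rightarrow> 'e::banach) \<Rightarrow> (real \<Rightarrow> 'e) set" where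
  "ae_class f = {g. AE x in unit_lebesgue. g x = f x}"

text \<open>The operations are computed on chosen representatives; any other choice gives the same
  classes and the same norm.\<close>

definition Lp :: "real \<Rightarrow> (real \<Rightarrow> 'e::banach) set normed_module" where
  "Lp p =
     \<lparr>carrier = ae_class ` Lp_functions p,
      mult = undefined,
      one = undefined,
      zero = ae_class (\<lambda>x. 0),
      add = (\<lambda>A B. ae_class (\<lambda>x. (SOME f. f \<in> A) x + (SOME g. g \<in> B) x)),
      smult = (\<lambda>c A. ae_class (\<lambda>x. c *\<^sub>R (SOME f. f \<in> A) x)),
      vnorm = (\<lambda>A. (LINT x|unit_lebesgue. norm ((SOME f. f \<in> A) x) powr p) powr (1 / p))\<rparr>"

end

(* Let m be an invariant mean on the bounded left uniformly continuous functions on G. On bounded left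
   uniformly continuous maps xi : G -> E the expression m(|xi|^p)^(1/p) is a seminorm, G acts by the
   isometries (g xi)(x) = xi(x g), and b(g)(x) = sigma(x g) - sigma(x) is a cocycle whose norm is
   controlled above and below by sigma, since (x, x g) is coarsely as far apart as (1, g). V is the
   completion; it is finitely representable in L^p(E) because m is approximated, on finitely many
   functions, by averages over finite subsets of G, and l^p-sums of copies of E sit in L^p(E) as step
   functions. A dense image of an amenable group inherits an invariant mean by pulling functions
   back. For a chain of compact subgroups no Haar measure is needed: minimal nets in a compact group
   are almost invariant under translation, by Hall's marriage theorem, and a cluster point of the
   averages over such nets is invariant. *)

theory Submission
  imports Defs "HOL-Library.Function_Algebras"
begin

section \<open>Quotients and completions of seminormed spaces\<close>

text \<open>The function \<sigma> is in general unbounded, so the mean cannot be applied to it; only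
  the differences \<sigma>(x g) - \<sigma>(x) are bounded, uniformly in x, because every continuous
  left-invariant ecart gives (x g, x) the same value as (g, 1). A mean is merely finitely additive:
  m(|\<xi>|^p)^(1/p) need not come from a measure, may have null vectors and may be incomplete.
  Hence V is an abstract quotient of Cauchy sequences, and finite representability has to be checked
  on spans of Cauchy sequences. The two approximations there, a late term of each sequence and then
  a finite average, hold only vector by vector; compactness of a unit sphere reduces the whole
  subspace to finitely many vectors. Right translations fit the left-uniform structure because inv
  (x h) (x g) = inv h g does not depend on x. Continuity of the action and of b, and the passage
  from a dense subgroup to G, rest on this identity. In the compact case right translation preserves
  instead the closeness z inv x, and a conjugation that is uniform over the compact group turns it
  into closeness of the left kind.\<close>

instantiation "fun" :: (type, real_vector) real_vector
begin

text \<open>The pointwise structure makes both functions on the group and sequences of such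
  functions real vectors, so that \<open>subspace\<close> and \<open>span\<close> apply on either
  level.\<close>

definition scaleR_fun :: "real \<Rightarrow> ('a \<Rightarrow> 'b) \<Rightarrow> 'a \<Rightarrow> 'b" where
  "scaleR_fun c f = (\<lambda>x. c *\<^sub>R f x)"

instance
  by standard (simp_all add: scaleR_fun_def fun_eq_iff algebra_simps)

end

lemma scaleR_fun_apply [simp]: "(c *\<^sub>R f) x = c *\<^sub>R f x" for f :: "'a \<Rightarrow> 'b::real_vector"
  by (simp add: scaleR_fun_def)

text \<open>Everything is relative to a subset \<open>Y\<close>, since the same facts are needed for
  \<open>BL\<close>, for the Cauchy sequences over it and for the span of a finite set.
  Nonnegativity is a consequence: 0 = \<open>N (x + - x)\<close> \<le>
  \<open>2 * N x\<close>.\<close>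

locale seminormed =
  fixes Y :: "'y::real_vector set" and N :: "'y \<Rightarrow> real"
  assumes subspace_Y: "subspace Y"
    and scale: "x \<in> Y \<Longrightarrow> N (c *\<^sub>R x) = \<bar>c\<bar> * N x"
    and triangle: "x \<in> Y \<Longrightarrow> y \<in> Y \<Longrightarrow> N (x + y) \<le> N x + N y"
begin

lemma mem [simp]:
  "0 \<in> Y" "x \<in> Y \<Longrightarrow> y \<in> Y \<Longrightarrow> x + y \<in> Y" "x \<in> Y \<Longrightarrow> y \<in> Y \<Longrightarrow> x - y \<in> Y"
  "x \<in> Y \<Longrightarrow> c *\<^sub>R x \<in> Y" "x \<in> Y \<Longrightarrow> - x \<in> Y"
  using subspace_Y by (auto simp: subspace_0 subspace_add subspace_diff subspace_scale subspace_neg)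

lemma zero [simp]: "N 0 = 0"
  using scale [of 0 0] by simp

lemma minus: "x \<in> Y \<Longrightarrow> N (- x) = N x"
  using scale [of x "-1"] by simp

lemma nonneg: "x \<in> Y \<Longrightarrow> 0 \<le> N x"
  using triangle [of x "- x"] by (simp add: minus)

lemma minus_commute: "x \<in> Y \<Longrightarrow> y \<in> Y \<Longrightarrow> N (x - y) = N (y - x)"
  using minus [of "x - y"] by simp

lemma triangle_via: "x \<in> Y \<Longrightarrow> y \<in> Y \<Longrightarrow> z \<in> Y \<Longrightarrow> N (x - z) \<le> N (x - y) + N (y - z)"
  using triangle [of "x - y" "y - z"] by simp

lemma reverse_triangle: "x \<in> Y \<Longrightarrow> y \<in> Y \<Longrightarrow> \<bar>N x - N y\<bar> \<le> N (x - y)"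
  using triangle [of "x - y" y] triangle [of "y - x" x] minus_commute [of x y] by simp

lemma eq_if_null_diff: "x \<in> Y \<Longrightarrow> y \<in> Y \<Longrightarrow> N (x - y) = 0 \<Longrightarrow> N x = N y"
  using reverse_triangle [of x y] by simp

lemma null_diff_trans:
  "x \<in> Y \<Longrightarrow> y \<in> Y \<Longrightarrow> z \<in> Y \<Longrightarrow> N (x - y) = 0 \<Longrightarrow> N (y - z) = 0 \<Longrightarrow> N (x - z) = 0"
  using triangle_via [of x y z] nonneg [of "x - z"] by simp

lemma sum_le: "finite A \<Longrightarrow> f \<in> A \<rightarrow> Y \<Longrightarrow> N (sum f A) \<le> (\<Sum>a\<in>A. N (f a))"
proof (induction A rule: finite_induct)
  case (insert a A)
  moreover have "sum f A \<in> Y"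
    using insert.prems by (intro subspace_sum [OF subspace_Y]) auto
  ultimately show ?case
    using triangle [of "f a" "sum f A"] by fastforce
qed simp

end

definition null_class :: "'y::real_vector set \<Rightarrow> ('y \<Rightarrow> real) \<Rightarrow> 'y \<Rightarrow> 'y set" where
  "null_class Y N x = {y \<in> Y. N (y - x) = 0}"

text \<open>The quotient by the null vectors of \<open>N\<close>. As in \<open>Lp\<close>, the
  operations act on representatives chosen by \<open>SOME\<close>; \<open>rep\<close> makes the
  choice harmless, since members of one class differ by a null vector.\<close>

definition quotient_space ::
  "'y::real_vector set \<Rightarrow> ('y \<Rightarrow> real) \<Rightarrow> 'y set normed_module" where
  "quotient_space Y N =
     \<lparr>carrier = null_class Y N ` Y, mult = undefined, one = undefined,
      zero = null_class Y N 0,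
      add = (\<lambda>A B. null_class Y N ((SOME x. x \<in> A) + (SOME y. y \<in> B))),
      smult = (\<lambda>c A. null_class Y N (c *\<^sub>R (SOME x. x \<in> A))),
      vnorm = (\<lambda>A. N (SOME x. x \<in> A))\<rparr>"

context seminormed
begin

abbreviation "Q \<equiv> quotient_space Y N"
abbreviation "cls \<equiv> null_class Y N"

lemma self_in_cls: "x \<in> Y \<Longrightarrow> x \<in> cls x"
  by (simp add: null_class_def)

lemma cls_eq_iff: "cls x = cls y \<longleftrightarrow> N (x - y) = 0" if xy: "x \<in> Y" "y \<in> Y"
proof
  assume "cls x = cls y"
  then have "x \<in> cls y"
    using self_in_cls xy by blast
  then show "N (x - y) = 0"
    by (simp add: null_class_def)
next
  have "cls x \<subseteq> cls y" if "x \<in> Y" "y \<in> Y" "N (x - y) = 0" for x y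
    unfolding null_class_def using null_diff_trans that by blast
  moreover assume "N (x - y) = 0"
  ultimately show "cls x = cls y"
    using xy minus_commute [of x y] by (metis subset_antisym)
qed

lemma rep:
  assumes "x \<in> Y"
  shows "(SOME y. y \<in> cls x) \<in> Y" "N ((SOME y. y \<in> cls x) - x) = 0"
proof -
  have "x \<in> cls x"
    using assms by (simp add: null_class_def)
  then have "(SOME y. y \<in> cls x) \<in> cls x"
    by (rule someI)
  then show "(SOME y. y \<in> cls x) \<in> Y" "N ((SOME y. y \<in> cls x) - x) = 0"
    by (auto simp: null_class_def)
qed

lemma carrier_Q: "carrier Q = cls ` Y"
  by (simp add: quotient_space_def)

lemma cls_in_Q [simp, intro]: "x \<in> Y \<Longrightarrow> cls x \<in> carrier Q"
  by (simp add: quotient_space_def)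

lemma zero_Q: "\<zero>\<^bsub>Q\<^esub> = cls 0"
  by (simp add: quotient_space_def)

lemma add_Q: "cls x \<oplus>\<^bsub>Q\<^esub> cls y = cls (x + y)" if xy: "x \<in> Y" "y \<in> Y"
proof -
  have "N ((SOME a. a \<in> cls x) + (SOME b. b \<in> cls y) - (x + y)) = 0"
    using triangle [of "(SOME a. a \<in> cls x) - x" "(SOME b. b \<in> cls y) - y"]
      nonneg [of "((SOME a. a \<in> cls x) - x) + ((SOME b. b \<in> cls y) - y)"] rep xy
    by (simp add: algebra_simps)
  then show ?thesis
    using rep xy by (simp add: quotient_space_def cls_eq_iff)
qed

lemma smult_Q: "c \<odot>\<^bsub>Q\<^esub> cls x = cls (c *\<^sub>R x)" if x: "x \<in> Y"
proof -
  have "N (c *\<^sub>R (SOME a. a \<in> cls x) - c *\<^sub>R x) = 0"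
    using scale [of "(SOME a. a \<in> cls x) - x" c] rep x by (simp add: algebra_simps)
  then show ?thesis
    using rep x by (simp add: quotient_space_def cls_eq_iff)
qed

lemma vnorm_Q: "vnorm Q (cls x) = N x" if x: "x \<in> Y"
  using eq_if_null_diff [of "SOME a. a \<in> cls x" x] rep x by (simp add: quotient_space_def)

lemma cring_real_ring: "cring real_ring"
proof (rule cringI)
  show "abelian_group real_ring"
  proof (rule abelian_groupI)
    show "\<exists>y\<in>carrier real_ring. y \<oplus>\<^bsub>real_ring\<^esub> x = \<zero>\<^bsub>real_ring\<^esub>" for x
      by (rule bexI [of _ "- x"]) (simp_all add: real_ring_def)
  qed (simp_all add: real_ring_def)
  show "comm_monoid real_ring"
    by (rule comm_monoidI) (auto simp: real_ring_def)
qed (auto simp: real_ring_def algebra_simps)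

lemma Q_cases:
  assumes "A \<in> carrier Q"
  obtains x where "x \<in> Y" "A = cls x"
  using assms unfolding carrier_Q by blast

lemma module_Q: "module real_ring Q"
proof (rule moduleI)
  show "cring real_ring"
    by (rule cring_real_ring)
  show "abelian_group Q"
  proof (rule abelian_groupI)
    fix A B assume "A \<in> carrier Q" "B \<in> carrier Q"
    then obtain x y where xy: "x \<in> Y" "A = cls x" "y \<in> Y" "B = cls y"
      by (metis Q_cases)
    show "A \<oplus>\<^bsub>Q\<^esub> B \<in> carrier Q" "A \<oplus>\<^bsub>Q\<^esub> B = B \<oplus>\<^bsub>Q\<^esub> A" "\<zero>\<^bsub>Q\<^esub> \<oplus>\<^bsub>Q\<^esub> A = A"
      using xy by (simp_all add: add_Q zero_Q add.commute)
    show "\<exists>B\<in>carrier Q. B \<oplus>\<^bsub>Q\<^esub> A = \<zero>\<^bsub>Q\<^esub>"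
      by (rule bexI [of _ "cls (- x)"]) (use xy in \<open>simp_all add: add_Q zero_Q\<close>)
    fix C assume "C \<in> carrier Q"
    then obtain z where "z \<in> Y" "C = cls z"
      by (rule Q_cases)
    then show "A \<oplus>\<^bsub>Q\<^esub> B \<oplus>\<^bsub>Q\<^esub> C = A \<oplus>\<^bsub>Q\<^esub> (B \<oplus>\<^bsub>Q\<^esub> C)"
      using xy by (simp add: add_Q add.assoc)
  qed (simp add: zero_Q)
next
  fix a b :: real and A B
  assume "A \<in> carrier Q" "B \<in> carrier Q"
  then obtain x y where xy: "x \<in> Y" "A = cls x" "y \<in> Y" "B = cls y"
    by (metis Q_cases)
  show "a \<odot>\<^bsub>Q\<^esub> A \<in> carrier Q" "(a \<oplus>\<^bsub>real_ring\<^esub> b) \<odot>\<^bsub>Q\<^esub> A = a \<odot>\<^bsub>Q\<^esub> A \<oplus>\<^bsub>Q\<^esub> b \<odot>\<^bsub>Q\<^esub> A"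
    "a \<odot>\<^bsub>Q\<^esub> (A \<oplus>\<^bsub>Q\<^esub> B) = a \<odot>\<^bsub>Q\<^esub> A \<oplus>\<^bsub>Q\<^esub> a \<odot>\<^bsub>Q\<^esub> B"
    "(a \<otimes>\<^bsub>real_ring\<^esub> b) \<odot>\<^bsub>Q\<^esub> A = a \<odot>\<^bsub>Q\<^esub> (b \<odot>\<^bsub>Q\<^esub> A)" "\<one>\<^bsub>real_ring\<^esub> \<odot>\<^bsub>Q\<^esub> A = A"
    using xy by (simp_all add: add_Q smult_Q real_ring_def scaleR_add_left scaleR_add_right)
qed

lemma minus_Q: "cls x \<ominus>\<^bsub>Q\<^esub> cls y = cls (x - y)" if xy: "x \<in> Y" "y \<in> Y"
proof -
  interpret module real_ring Q
    by (rule module_Q)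
  have "cls (- y) = \<ominus>\<^bsub>Q\<^esub> cls y"
    using xy by (intro M.minus_equality [symmetric]) (auto simp: add_Q zero_Q)
  then show ?thesis
    using xy add_Q [of x "- y"] by (simp add: a_minus_def)
qed

lemma vdist_Q: "x \<in> Y \<Longrightarrow> y \<in> Y \<Longrightarrow> vdist Q (cls x) (cls y) = N (x - y)"
  by (simp add: vdist_def minus_Q vnorm_Q)

lemma normed_space_Q: "normed_space Q"
  unfolding normed_space_def using module_Q
  by (auto simp: carrier_Q vnorm_Q smult_Q add_Q zero_Q cls_eq_iff nonneg scale triangle)

lemma Metric_space_Q: "Metric_space (carrier Q) (vdist Q)"
proof
  fix A B
  show "0 \<le> vdist Q A B"
    by (cases "A \<in> carrier Q \<and> B \<in> carrier Q")
      (auto simp: carrier_Q vdist_Q nonneg, auto simp: vdist_def carrier_Q)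
  show "vdist Q A B = vdist Q B A"
    by (cases "A \<in> carrier Q \<and> B \<in> carrier Q")
      (auto simp: carrier_Q vdist_Q intro: minus_commute, auto simp: vdist_def carrier_Q)
next
  fix A B assume "A \<in> carrier Q" "B \<in> carrier Q"
  then obtain x y where "x \<in> Y" "A = cls x" "y \<in> Y" "B = cls y"
    by (auto simp: carrier_Q)
  then show "vdist Q A B = 0 \<longleftrightarrow> A = B"
    by (simp add: vdist_Q cls_eq_iff)
next
  fix A B C assume "A \<in> carrier Q" "B \<in> carrier Q" "C \<in> carrier Q"
  then obtain x y z where "x \<in> Y" "A = cls x" "y \<in> Y" "B = cls y" "z \<in> Y" "C = cls z"
    by (auto simp: carrier_Q)
  then show "vdist Q A C \<le> vdist Q A B + vdist Q B C"
    using triangle_via [of x y z] by (simp add: vdist_Q)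
qed

end

section \<open>Completion by Cauchy sequences\<close>

definition cauchy_seqs :: "'x::real_vector set \<Rightarrow> ('x \<Rightarrow> real) \<Rightarrow> (nat \<Rightarrow> 'x) set" where
  "cauchy_seqs X N =
     {s. range s \<subseteq> X \<and> (\<forall>e>0. \<exists>M. \<forall>m\<ge>M. \<forall>n\<ge>M. N (s m - s n) < e)}"

lemma cauchy_seqsE:
  assumes "s \<in> cauchy_seqs X N" "0 < e"
  obtains M where "\<And>m n. m \<ge> M \<Longrightarrow> n \<ge> M \<Longrightarrow> N (s m - s n) < e"
proof -
  from assms have "\<exists>M. \<forall>m\<ge>M. \<forall>n\<ge>M. N (s m - s n) < e"
    unfolding cauchy_seqs_def by simp
  then show thesis
    using that by blast
qed

definition lim_norm :: "('x \<Rightarrow> real) \<Rightarrow> (nat \<Rightarrow> 'x) \<Rightarrow> real" where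
  "lim_norm N s = lim (\<lambda>n. N (s n))"

text \<open>One quotient does two things: it identifies equivalent Cauchy sequences and kills the
  null vectors of \<open>N\<close>, so a seminorm is enough to start with. It also fixes the type of
  \<open>V\<close> in the final theorem.\<close>

abbreviation completion :: "'x::real_vector set \<Rightarrow> ('x \<Rightarrow> real) \<Rightarrow> (nat \<Rightarrow> 'x) set normed_module"
  where "completion X N \<equiv> quotient_space (cauchy_seqs X N) (lim_norm N)"

context seminormed
begin

lemma cauchy_seqs_mem: "s \<in> cauchy_seqs Y N \<Longrightarrow> s n \<in> Y"
  by (auto simp: cauchy_seqs_def)

lemma lim_norm: "(\<lambda>n. N (s n)) \<longlonglongrightarrow> lim_norm N s" if s: "s \<in> cauchy_seqs Y N"
proof -
  have "Cauchy (\<lambda>n. N (s n))"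
  proof (rule CauchyI)
    fix e :: real assume "0 < e"
    then obtain M where M: "\<And>m n. m \<ge> M \<Longrightarrow> n \<ge> M \<Longrightarrow> N (s m - s n) < e"
      using cauchy_seqsE [OF s \<open>0 < e\<close>] by metis
    show "\<exists>M. \<forall>m\<ge>M. \<forall>n\<ge>M. norm (N (s m) - N (s n)) < e"
    proof (intro exI allI impI)
      fix m n assume "m \<ge> M" "n \<ge> M"
      then show "norm (N (s m) - N (s n)) < e"
        using M [of m n] reverse_triangle [of "s m" "s n"] cauchy_seqs_mem [OF s] by simp
    qed
  qed
  then show ?thesis
    unfolding lim_norm_def by (simp add: Cauchy_convergent convergent_LIMSEQ_iff [symmetric])
qed

lemma lim_norm_eqI: "s \<in> cauchy_seqs Y N \<Longrightarrow> (\<lambda>n. N (s n)) \<longlonglongrightarrow> l \<Longrightarrow> lim_norm N s = l"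
  by (rule LIMSEQ_unique [OF lim_norm])

lemma const_cauchy [simp]: "x \<in> Y \<Longrightarrow> (\<lambda>n. x) \<in> cauchy_seqs Y N"
  by (auto simp: cauchy_seqs_def)

lemma lim_norm_const [simp]: "lim_norm N (\<lambda>n. x) = N x"
  by (simp add: lim_norm_def)

lemma seminormed_completion: "seminormed (cauchy_seqs Y N) (lim_norm N)"
proof
  have add: "s + t \<in> cauchy_seqs Y N" if s: "s \<in> cauchy_seqs Y N" and t: "t \<in> cauchy_seqs Y N" for s t
    unfolding cauchy_seqs_def
  proof (intro CollectI conjI allI impI)
    show "range (s + t) \<subseteq> Y"
      using cauchy_seqs_mem s t by auto
    fix e :: real assume "e > 0"
    then have e: "e / 2 > 0"
      by simp
    obtain M1 where M1: "\<And>m n. m \<ge> M1 \<Longrightarrow> n \<ge> M1 \<Longrightarrow> N (s m - s n) < e / 2"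
      using cauchy_seqsE [OF s e] by metis
    obtain M2 where M2: "\<And>m n. m \<ge> M2 \<Longrightarrow> n \<ge> M2 \<Longrightarrow> N (t m - t n) < e / 2"
      using cauchy_seqsE [OF t e] by metis
    show "\<exists>M. \<forall>m\<ge>M. \<forall>n\<ge>M. N ((s + t) m - (s + t) n) < e"
    proof (intro exI allI impI)
      fix m n assume "m \<ge> max M1 M2" "n \<ge> max M1 M2"
      then show "N ((s + t) m - (s + t) n) < e"
        using M1 [of m n] M2 [of m n] triangle [of "s m - s n" "t m - t n"]
          cauchy_seqs_mem [OF s] cauchy_seqs_mem [OF t]
        by (simp add: algebra_simps)
    qed
  qed
  have scl: "c *\<^sub>R s \<in> cauchy_seqs Y N" if s: "s \<in> cauchy_seqs Y N" for c s
    unfolding cauchy_seqs_def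
  proof (intro CollectI conjI allI impI)
    show "range (c *\<^sub>R s) \<subseteq> Y"
      using cauchy_seqs_mem s by auto
    fix e :: real assume "e > 0"
    \<comment> \<open>The summand 1 keeps the divisor positive when \<open>c\<close> is 0.\<close>
    then have e: "e / (\<bar>c\<bar> + 1) > 0"
      by simp
    obtain M where M: "\<And>m n. m \<ge> M \<Longrightarrow> n \<ge> M \<Longrightarrow> N (s m - s n) < e / (\<bar>c\<bar> + 1)"
      using cauchy_seqsE [OF s e] by metis
    show "\<exists>M. \<forall>m\<ge>M. \<forall>n\<ge>M. N ((c *\<^sub>R s) m - (c *\<^sub>R s) n) < e"
    proof (intro exI allI impI)
      fix m n assume "m \<ge> M" "n \<ge> M"
      then have "(\<bar>c\<bar> + 1) * N (s m - s n) < e"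
        using M [of m n] by (simp add: field_simps)
      moreover have "N (c *\<^sub>R (s m - s n)) = \<bar>c\<bar> * N (s m - s n)" "0 \<le> N (s m - s n)"
        using cauchy_seqs_mem [OF s] by (simp_all add: scale nonneg)
      ultimately show "N ((c *\<^sub>R s) m - (c *\<^sub>R s) n) < e"
        by (simp add: algebra_simps)
    qed
  qed
  have "0 \<in> cauchy_seqs Y N"
    using const_cauchy [of 0] by (simp add: zero_fun_def)
  then show "subspace (cauchy_seqs Y N)"
    using add scl by (auto simp: subspace_def)
  fix s c assume s: "s \<in> cauchy_seqs Y N"
  have "(\<lambda>n. \<bar>c\<bar> * N (s n)) \<longlonglongrightarrow> \<bar>c\<bar> * lim_norm N s"
    by (intro tendsto_intros lim_norm s)
  then show "lim_norm N (c *\<^sub>R s) = \<bar>c\<bar> * lim_norm N s"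
    using cauchy_seqs_mem [OF s] by (intro lim_norm_eqI scl s) (simp add: scale)
  fix t assume t: "t \<in> cauchy_seqs Y N"
  show "lim_norm N (s + t) \<le> lim_norm N s + lim_norm N t"
    using lim_norm [OF add [OF s t]] tendsto_add [OF lim_norm [OF s] lim_norm [OF t]]
    by (rule LIMSEQ_le) (use triangle cauchy_seqs_mem s t in auto)
qed

text \<open>Beyond the Cauchy index for \<open>e / 2\<close> all terms stay within
  \<open>e / 2\<close> of \<open>s n\<close>, and this bound survives the limit defining
  \<open>lim_norm\<close>.\<close>

lemma const_dense:
  assumes s: "s \<in> cauchy_seqs Y N" and "0 < e"
  shows "\<forall>\<^sub>F n in sequentially. lim_norm N (s - (\<lambda>_. s n)) < e"
proof -
  interpret C: seminormed "cauchy_seqs Y N" "lim_norm N"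
    by (rule seminormed_completion)
  have e: "e / 2 > 0"
    using \<open>0 < e\<close> by simp
  obtain M where M: "\<And>m n. m \<ge> M \<Longrightarrow> n \<ge> M \<Longrightarrow> N (s m - s n) < e / 2"
    using cauchy_seqsE [OF s e] by metis
  have "lim_norm N (s - (\<lambda>_. s n)) \<le> e / 2" if "n \<ge> M" for n
  proof (rule LIMSEQ_le_const2)
    show "(\<lambda>m. N ((s - (\<lambda>_. s n)) m)) \<longlonglongrightarrow> lim_norm N (s - (\<lambda>_. s n))"
      by (rule lim_norm [OF C.mem(3) [OF s const_cauchy [OF cauchy_seqs_mem [OF s]]]])
    show "\<exists>K. \<forall>m\<ge>K. N ((s - (\<lambda>_. s n)) m) \<le> e / 2"
      using M [OF _ that] by (simp add: exI [of _ M] less_imp_le)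
  qed
  then have "lim_norm N (s - (\<lambda>_. s n)) < e" if "n \<ge> M" for n
    using that \<open>0 < e\<close> by fastforce
  then show ?thesis
    by (rule eventually_sequentiallyI)
qed

text \<open>A diagonal argument: \<open>A k\<close> is approximated within 1/(k+1) by a constant
  sequence with value \<open>t k\<close>. Then \<open>t\<close> is itself a Cauchy sequence over
  \<open>Y\<close>, and its class is the limit.\<close>

lemma banach_space_completion: "banach_space (completion Y N)"
proof -
  interpret C: seminormed "cauchy_seqs Y N" "lim_norm N"
    by (rule seminormed_completion)
  interpret M: Metric_space "carrier C.Q" "vdist C.Q"
    by (rule C.Metric_space_Q)
  have "M.mcomplete"
    unfolding M.mcomplete_def
  proof (intro allI impI)
    fix A assume A: "M.MCauchy A"
    then have "\<forall>k. \<exists>s\<in>cauchy_seqs Y N. A k = C.cls s"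
      unfolding M.MCauchy_def using C.Q_cases by (metis rangeI subsetD)
    then obtain r where r: "\<And>k. r k \<in> cauchy_seqs Y N" "\<And>k. A k = C.cls (r k)"
      by metis
    have "\<exists>n. lim_norm N (r k - (\<lambda>_. r k n)) < inverse (Suc k)" for k
      using eventually_happens [OF const_dense [OF r(1) [of k], of "inverse (Suc k)"]] by auto
    then obtain n where n: "\<And>k. lim_norm N (r k - (\<lambda>_. r k (n k))) < inverse (Suc k)"
      by metis
    define t where "t k = r k (n k)" for k
    have t_mem: "t k \<in> Y" for k
      by (simp add: t_def cauchy_seqs_mem r)
    have n: "lim_norm N (r k - (\<lambda>_. t k)) < inverse (Suc k)" for k
      using n by (simp add: t_def)
    have dist_t: "N (t k - t l) \<le> inverse (Suc k) + inverse (Suc l) + vdist C.Q (A k) (A l)" for k l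
    proof -
      have "N (t k - t l) = lim_norm N ((\<lambda>_. t k) - (\<lambda>_. t l))"
        using lim_norm_const [of "t k - t l"] by (simp add: fun_diff_def)
      also have "\<dots> \<le> lim_norm N ((\<lambda>_. t k) - r k) + lim_norm N (r k - (\<lambda>_. t l))"
        using t_mem r(1) by (intro C.triangle_via) auto
      also have "lim_norm N (r k - (\<lambda>_. t l)) \<le> lim_norm N (r k - r l) + lim_norm N (r l - (\<lambda>_. t l))"
        using t_mem r(1) by (intro C.triangle_via) auto
      finally show ?thesis
        using n [of k] n [of l] C.minus_commute [OF const_cauchy [OF t_mem [of k]] r(1) [of k]]
          C.vdist_Q [OF r(1) [of k] r(1) [of l]]
        unfolding r(2) by linarith
    qed
    have t: "t \<in> cauchy_seqs Y N"
      unfolding cauchy_seqs_def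
    proof (intro CollectI conjI allI impI)
      show "range t \<subseteq> Y"
        using t_mem by auto
      fix e :: real assume "e > 0"
      then have "e / 3 > 0"
        by simp
      obtain K where K: "\<And>k. k \<ge> K \<Longrightarrow> inverse (real (Suc k)) < e / 3"
        using order_tendstoD(2) [OF LIMSEQ_inverse_real_of_nat \<open>e / 3 > 0\<close>]
        by (auto simp: eventually_sequentially)
      obtain L where L: "\<And>k l. k \<ge> L \<Longrightarrow> l \<ge> L \<Longrightarrow> vdist C.Q (A k) (A l) < e / 3"
        using A \<open>e / 3 > 0\<close> unfolding M.MCauchy_def by blast
      show "\<exists>M. \<forall>k\<ge>M. \<forall>l\<ge>M. N (t k - t l) < e"
      proof (intro exI allI impI)
        fix k l assume "k \<ge> max K L" "l \<ge> max K L"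
        then show "N (t k - t l) < e"
          using dist_t [of k l] K [of k] K [of l] L [of k l] by simp
      qed
    qed
    have "limitin M.mtopology A (C.cls t) sequentially"
      unfolding M.limitin_metric
    proof (intro conjI allI impI)
      show "C.cls t \<in> carrier C.Q"
        using t by blast
      fix e :: real assume "e > 0"
      then have "e / 2 > 0"
        by simp
      show "\<forall>\<^sub>F k in sequentially. A k \<in> carrier C.Q \<and> vdist C.Q (A k) (C.cls t) < e"
        using const_dense [OF t \<open>e / 2 > 0\<close>] order_tendstoD(2) [OF LIMSEQ_inverse_real_of_nat \<open>e / 2 > 0\<close>]
      proof eventually_elim
        case (elim k)
        have "lim_norm N (r k - t) \<le> lim_norm N (r k - (\<lambda>_. t k)) + lim_norm N ((\<lambda>_. t k) - t)"
          using r t t_mem by (intro C.triangle_via) auto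
        then show ?case
          using elim n [of k] C.minus_commute [OF const_cauchy [OF t_mem [of k]] t]
            C.vdist_Q [OF r(1) [of k] t] C.cls_in_Q [OF r(1) [of k]]
          unfolding r(2) by simp
      qed
    qed
    then show "\<exists>x. limitin M.mtopology A x sequentially"
      by blast
  qed
  then show ?thesis
    by (simp add: banach_space_def C.normed_space_Q)
qed

end

section \<open>Means on bounded left uniformly continuous functions\<close>

locale top_group = group G for G :: "'g monoid" (structure) and T :: "'g topology" +
  assumes topological_group: "topological_group G T"
begin

lemma topspace_T [simp]: "topspace T = carrier G"
  using topological_group by (simp add: topological_group_def)

lemma open_subset: "openin T U \<Longrightarrow> U \<subseteq> carrier G"
  using openin_subset by fastforce

lemma continuous_mult:
  assumes "continuous_map X T f" "continuous_map X T h"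
  shows "continuous_map X T (\<lambda>x. f x \<otimes> h x)"
proof -
  have "continuous_map (prod_topology T T) T (\<lambda>(x, y). x \<otimes> y)"
    using topological_group by (simp add: topological_group_def)
  from continuous_map_compose [OF continuous_map_pairedI [OF assms] this] show ?thesis
    by (simp add: o_def)
qed

lemma continuous_inverse:
  assumes "continuous_map X T f"
  shows "continuous_map X T (\<lambda>x. inv f x)"
proof -
  have "continuous_map T T (\<lambda>x. inv x)"
    using topological_group by (simp add: topological_group_def)
  from continuous_map_compose [OF assms this] show ?thesis
    by (simp add: o_def)
qed

lemma continuous_const: "a \<in> carrier G \<Longrightarrow> continuous_map X T (\<lambda>_. a)"
  by simp

lemma continuous_ident: "continuous_map T T (\<lambda>x. x)"
  by simp

lemmas continuous_group_intros = continuous_mult continuous_inverse continuous_const continuous_ident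

lemma open_preimage:
  "continuous_map T T f \<Longrightarrow> openin T U \<Longrightarrow> openin T {x \<in> carrier G. f x \<in> U}"
  using openin_continuous_map_preimage [of T T f U] by simp

lemma inv_mult_cancel [simp]:
  "x \<in> carrier G \<Longrightarrow> y \<in> carrier G \<Longrightarrow> inv x \<otimes> (x \<otimes> y) = y"
  "x \<in> carrier G \<Longrightarrow> y \<in> carrier G \<Longrightarrow> x \<otimes> (inv x \<otimes> y) = y"
  by (simp_all add: m_assoc [symmetric])

end

text \<open>\<open>bounded_left_uniform\<close> with values in any normed space: means act on the
  real case, while the vectors of the representation are functions into the Banach space.\<close>

definition bounded_luc :: "'g monoid \<Rightarrow> 'g topology \<Rightarrow> ('g \<Rightarrow> 'e::real_normed_vector) set" where
  "bounded_luc G T = {f. bounded (f ` carrier G) \<and> left_uniformly_continuous G T dist f}"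

lemma bounded_left_uniform_eq: "bounded_left_uniform G T = bounded_luc G T"
  by (simp add: bounded_left_uniform_def bounded_luc_def)

lemma bounded_lucE:
  assumes "f \<in> bounded_luc G T"
  obtains c where "0 < c" "\<And>x. x \<in> carrier G \<Longrightarrow> norm (f x) \<le> c"
  using assms unfolding bounded_luc_def bounded_pos by auto

lemma left_uniformly_continuousE:
  assumes "left_uniformly_continuous G T D f" "0 < e"
  obtains U where "openin T U" "\<one>\<^bsub>G\<^esub> \<in> U"
    "\<And>x y. x \<in> carrier G \<Longrightarrow> y \<in> carrier G \<Longrightarrow> inv\<^bsub>G\<^esub> x \<otimes>\<^bsub>G\<^esub> y \<in> U \<Longrightarrow> D (f x) (f y) < e"
proof -
  have "\<exists>U. openin T U \<and> \<one>\<^bsub>G\<^esub> \<in> U \<and>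
      (\<forall>x\<in>carrier G. \<forall>y\<in>carrier G. inv\<^bsub>G\<^esub> x \<otimes>\<^bsub>G\<^esub> y \<in> U \<longrightarrow> D (f x) (f y) < e)"
    using assms unfolding left_uniformly_continuous_def by simp
  then show thesis
    using that by metis
qed

text \<open>The range of \<open>f\<close> lies in a ball, so uniform continuity of \<open>h\<close>
  on balls suffices; t^p is not uniformly continuous on the whole half-line when p > 1.\<close>

lemma bounded_luc_uniformly_continuous_compose:
  assumes f: "f \<in> bounded_luc G T" and h: "\<And>r. uniformly_continuous_on (cball 0 r) h"
    and b: "\<And>r. bounded (h ` cball 0 r)"
  shows "(\<lambda>x. h (f x)) \<in> bounded_luc G T"
proof -
  obtain c where c: "0 < c" "\<And>x. x \<in> carrier G \<Longrightarrow> norm (f x) \<le> c"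
    using f by (rule bounded_lucE) blast
  have "(\<lambda>x. h (f x)) ` carrier G \<subseteq> h ` cball 0 c"
    using c by auto
  then have "bounded ((\<lambda>x. h (f x)) ` carrier G)"
    using b bounded_subset by metis
  moreover have "left_uniformly_continuous G T dist (\<lambda>x. h (f x))"
    unfolding left_uniformly_continuous_def
  proof (intro allI impI)
    fix e :: real assume "0 < e"
    then obtain d where d: "0 < d"
      "\<And>v w. norm v \<le> c \<Longrightarrow> norm w \<le> c \<Longrightarrow> dist w v < d \<Longrightarrow> dist (h w) (h v) < e"
      using h [of c] unfolding uniformly_continuous_on_def by (metis mem_cball_0)
    have "left_uniformly_continuous G T dist f"
      using f by (simp add: bounded_luc_def)
    then obtain U where U: "openin T U" "\<one>\<^bsub>G\<^esub> \<in> U"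
      "\<And>x y. x \<in> carrier G \<Longrightarrow> y \<in> carrier G \<Longrightarrow> inv\<^bsub>G\<^esub> x \<otimes>\<^bsub>G\<^esub> y \<in> U \<Longrightarrow> dist (f x) (f y) < d"
      using \<open>0 < d\<close> by (rule left_uniformly_continuousE) blast
    then show "\<exists>U. openin T U \<and> \<one>\<^bsub>G\<^esub> \<in> U \<and>
        (\<forall>x\<in>carrier G. \<forall>y\<in>carrier G. inv\<^bsub>G\<^esub> x \<otimes>\<^bsub>G\<^esub> y \<in> U \<longrightarrow> dist (h (f x)) (h (f y)) < e)"
      using c(2) d(2) by (intro exI [of _ U]) simp
  qed
  ultimately show ?thesis
    by (simp add: bounded_luc_def)
qed

lemma norm_powr_bounded_luc:
  fixes f :: "'g \<Rightarrow> 'e::real_normed_vector"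
  assumes f: "f \<in> bounded_luc G T" and p: "0 < p"
  shows "(\<lambda>x. norm (f x) powr p) \<in> bounded_luc G T"
proof -
  have "(\<lambda>x. norm (f x)) \<in> bounded_luc G T"
  proof (rule bounded_luc_uniformly_continuous_compose [OF f])
    show "uniformly_continuous_on (cball 0 r) norm" for r
      by (intro uniformly_continuous_on_norm uniformly_continuous_on_id)
    show "bounded (norm ` cball 0 r)" for r
      by (auto simp: bounded_iff)
  qed
  \<comment> \<open>The composition lemma needs uniform continuity on whole balls of reals, negative
    numbers included; the absolute value provides it and changes nothing on norms.\<close>
  then have "(\<lambda>x. \<bar>norm (f x)\<bar> powr p) \<in> bounded_luc G T"
  proof (rule bounded_luc_uniformly_continuous_compose)
    have "continuous_on (cball 0 r) (\<lambda>t::real. \<bar>t\<bar> powr p)" for r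
      using p by (intro continuous_on_powr' continuous_intros) auto
    then show "uniformly_continuous_on (cball 0 r) (\<lambda>t::real. \<bar>t\<bar> powr p)"
      "bounded ((\<lambda>t::real. \<bar>t\<bar> powr p) ` cball 0 r)" for r
      by (simp_all add: compact_uniformly_continuous compact_imp_bounded compact_continuous_image)
  qed
  then show ?thesis
    by simp
qed

context top_group
begin

abbreviation BL :: "('g \<Rightarrow> 'e::real_normed_vector) set" where
  "BL \<equiv> bounded_luc G T"

lemma bounded_luc_const: "(\<lambda>_. c) \<in> BL"
proof -
  have "left_uniformly_continuous G T dist (\<lambda>_. c)"
    unfolding left_uniformly_continuous_def
    using openin_topspace [of T] by auto
  then show ?thesis
    by (auto simp: bounded_luc_def image_constant_conv)
qed

lemma left_uniformly_continuous_add: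
  fixes f h :: "'g \<Rightarrow> 'e::real_normed_vector"
  assumes f: "left_uniformly_continuous G T dist f" and h: "left_uniformly_continuous G T dist h"
  shows "left_uniformly_continuous G T dist (\<lambda>x. f x + h x)"
  unfolding left_uniformly_continuous_def
proof (intro allI impI)
  fix e :: real assume "0 < e"
  then have e: "0 < e / 2"
    by simp
  obtain U where U: "openin T U" "\<one> \<in> U"
    "\<And>x y. x \<in> carrier G \<Longrightarrow> y \<in> carrier G \<Longrightarrow> inv x \<otimes> y \<in> U \<Longrightarrow> dist (f x) (f y) < e / 2"
    using f e by (rule left_uniformly_continuousE) blast
  obtain V where V: "openin T V" "\<one> \<in> V"
    "\<And>x y. x \<in> carrier G \<Longrightarrow> y \<in> carrier G \<Longrightarrow> inv x \<otimes> y \<in> V \<Longrightarrow> dist (h x) (h y) < e / 2"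
    using h e by (rule left_uniformly_continuousE) blast
  show "\<exists>U. openin T U \<and> \<one> \<in> U \<and>
      (\<forall>x\<in>carrier G. \<forall>y\<in>carrier G. inv x \<otimes> y \<in> U \<longrightarrow> dist (f x + h x) (f y + h y) < e)"
  proof (intro exI conjI ballI impI)
    show "openin T (U \<inter> V)" "\<one> \<in> U \<inter> V"
      using U V by auto
    fix x y assume "x \<in> carrier G" "y \<in> carrier G" "inv x \<otimes> y \<in> U \<inter> V"
    then show "dist (f x + h x) (f y + h y) < e"
      using U(3) [of x y] V(3) [of x y] dist_triangle_add [of "f x" "h x" "f y" "h y"] by simp
  qed
qed

lemma left_uniformly_continuous_scale:
  fixes f :: "'g \<Rightarrow> 'e::real_normed_vector"
  assumes f: "left_uniformly_continuous G T dist f"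
  shows "left_uniformly_continuous G T dist (\<lambda>x. c *\<^sub>R f x)"
  unfolding left_uniformly_continuous_def
proof (intro allI impI)
  fix e :: real assume "0 < e"
  then have e: "0 < e / (\<bar>c\<bar> + 1)"
    by simp
  obtain U where U: "openin T U" "\<one> \<in> U"
    "\<And>x y. x \<in> carrier G \<Longrightarrow> y \<in> carrier G \<Longrightarrow> inv x \<otimes> y \<in> U \<Longrightarrow> dist (f x) (f y) < e / (\<bar>c\<bar> + 1)"
    using f e by (rule left_uniformly_continuousE) blast
  show "\<exists>U. openin T U \<and> \<one> \<in> U \<and>
      (\<forall>x\<in>carrier G. \<forall>y\<in>carrier G. inv x \<otimes> y \<in> U \<longrightarrow> dist (c *\<^sub>R f x) (c *\<^sub>R f y) < e)"
  proof (intro exI conjI ballI impI)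
    fix x y assume "x \<in> carrier G" "y \<in> carrier G" "inv x \<otimes> y \<in> U"
    then have "(\<bar>c\<bar> + 1) * dist (f x) (f y) < e"
      using U(3) [of x y] by (simp add: field_simps)
    then show "dist (c *\<^sub>R f x) (c *\<^sub>R f y) < e"
      using norm_ge_zero [of "f x - f y"]
      by (simp add: dist_norm distrib_right flip: scaleR_diff_right del: norm_ge_zero)
  qed (use U in auto)
qed

lemma bounded_luc_add: "f \<in> BL \<Longrightarrow> h \<in> BL \<Longrightarrow> (\<lambda>x. f x + h x) \<in> BL"
  by (auto simp: bounded_luc_def intro: bounded_plus_comp left_uniformly_continuous_add)

lemma bounded_luc_scale: "f \<in> BL \<Longrightarrow> (\<lambda>x. c *\<^sub>R f x) \<in> BL"
  using bounded_scaling [of "f ` carrier G" c]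
  by (auto simp: bounded_luc_def image_image intro: left_uniformly_continuous_scale)

lemma subspace_bounded_luc: "subspace BL"
  using bounded_luc_const [of 0] bounded_luc_add bounded_luc_scale
  by (auto simp: subspace_def plus_fun_def scaleR_fun_def zero_fun_def)

lemma bounded_luc_mult: "f \<in> BL \<Longrightarrow> (\<lambda>x. c * f x) \<in> BL" for f :: "'g \<Rightarrow> real"
  using bounded_luc_scale [of f c] by simp

lemma bounded_luc_diff: "f \<in> BL \<Longrightarrow> h \<in> BL \<Longrightarrow> (\<lambda>x. f x - h x) \<in> BL"
  using subspace_diff [OF subspace_bounded_luc, of f h] by (simp add: fun_diff_def)

lemma bounded_luc_sum: "(\<And>a. a \<in> A \<Longrightarrow> f a \<in> BL) \<Longrightarrow> (\<lambda>x. \<Sum>a\<in>A. f a x) \<in> BL"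
  by (induction A rule: infinite_finite_induct) (auto simp: bounded_luc_const bounded_luc_add)

text \<open>Since inv (x g) (y g) = inv g (inv x y) g, the modulus of the translate is the preimage
  of \<open>U\<close> under a conjugation.\<close>

lemma left_uniformly_continuous_right_translate:
  assumes f: "left_uniformly_continuous G T D f" and g: "g \<in> carrier G"
  shows "left_uniformly_continuous G T D (\<lambda>x. f (x \<otimes> g))"
  unfolding left_uniformly_continuous_def
proof (intro allI impI)
  fix e :: real assume "0 < e"
  with f obtain U where U: "openin T U" "\<one> \<in> U"
    "\<And>x y. x \<in> carrier G \<Longrightarrow> y \<in> carrier G \<Longrightarrow> inv x \<otimes> y \<in> U \<Longrightarrow> D (f x) (f y) < e"
    by (rule left_uniformly_continuousE) blast
  show "\<exists>U. openin T U \<and> \<one> \<in> U \<and>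
      (\<forall>x\<in>carrier G. \<forall>y\<in>carrier G. inv x \<otimes> y \<in> U \<longrightarrow> D (f (x \<otimes> g)) (f (y \<otimes> g)) < e)"
  proof (intro exI conjI ballI impI)
    show "openin T {v \<in> carrier G. inv g \<otimes> v \<otimes> g \<in> U}"
      using U(1) g by (intro open_preimage continuous_group_intros) auto
    show "\<one> \<in> {v \<in> carrier G. inv g \<otimes> v \<otimes> g \<in> U}"
      using U(2) g by simp
    fix x y assume "x \<in> carrier G" "y \<in> carrier G"
      "inv x \<otimes> y \<in> {v \<in> carrier G. inv g \<otimes> v \<otimes> g \<in> U}"
    then show "D (f (x \<otimes> g)) (f (y \<otimes> g)) < e"
      using g U(3) [of "x \<otimes> g" "y \<otimes> g"] by (simp add: inv_mult_group m_assoc)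
  qed
qed

lemma bounded_luc_right_translate:
  assumes "f \<in> BL" "g \<in> carrier G"
  shows "(\<lambda>x. f (x \<otimes> g)) \<in> BL"
proof -
  have "bounded ((\<lambda>x. f (x \<otimes> g)) ` carrier G)"
    by (rule bounded_subset [of "f ` carrier G"]) (use assms in \<open>auto simp: bounded_luc_def\<close>)
  then show ?thesis
    using assms by (auto simp: bounded_luc_def intro: left_uniformly_continuous_right_translate)
qed

end

text \<open>Invariance is left out on purpose, so that averages over finite families of points are
  means too and share the theory of \<open>mean_norm\<close>.\<close>

locale mean = top_group G T for G :: "'g monoid" (structure) and T +
  fixes m :: "('g \<Rightarrow> real) \<Rightarrow> real"
  assumes m_add: "f \<in> BL \<Longrightarrow> h \<in> BL \<Longrightarrow> m (\<lambda>x. f x + h x) = m f + m h"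
    and m_mult: "f \<in> BL \<Longrightarrow> m (\<lambda>x. c * f x) = c * m f"
    and m_nonneg: "f \<in> BL \<Longrightarrow> (\<And>x. x \<in> carrier G \<Longrightarrow> 0 \<le> f x) \<Longrightarrow> 0 \<le> m f"
    and m_one: "m (\<lambda>x. 1) = 1"
begin

lemma m_const: "m (\<lambda>x. c) = c"
  using m_mult [OF bounded_luc_const [of 1], of c] m_one by simp

lemma m_diff: "f \<in> BL \<Longrightarrow> h \<in> BL \<Longrightarrow> m (\<lambda>x. f x - h x) = m f - m h"
  using m_add [of "\<lambda>x. f x - h x" h] bounded_luc_diff [of f h] by simp

lemma m_mono: "f \<in> BL \<Longrightarrow> h \<in> BL \<Longrightarrow> (\<And>x. x \<in> carrier G \<Longrightarrow> f x \<le> h x) \<Longrightarrow> m f \<le> m h"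
  using m_nonneg [of "\<lambda>x. h x - f x"] m_diff [of h f] bounded_luc_diff [of h f] by simp

lemma m_le: "f \<in> BL \<Longrightarrow> (\<And>x. x \<in> carrier G \<Longrightarrow> f x \<le> c) \<Longrightarrow> m f \<le> c"
  using m_mono [of f "\<lambda>_. c"] bounded_luc_const [of c] m_const [of c] by simp

lemma m_ge: "f \<in> BL \<Longrightarrow> (\<And>x. x \<in> carrier G \<Longrightarrow> c \<le> f x) \<Longrightarrow> c \<le> m f"
  using m_mono [of "\<lambda>_. c" f] bounded_luc_const [of c] m_const [of c] by simp

lemma m_abs_diff_le:
  assumes "f \<in> BL" "h \<in> BL" "\<And>x. x \<in> carrier G \<Longrightarrow> \<bar>f x - h x\<bar> \<le> c"
  shows "\<bar>m f - m h\<bar> \<le> c"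
proof -
  have "m f - m h \<le> c" "m h - m f \<le> c"
    using assms m_le [of "\<lambda>x. f x - h x" c] m_le [of "\<lambda>x. h x - f x" c] bounded_luc_diff m_diff
    by (force simp: abs_le_iff)+
  then show ?thesis
    by simp
qed

lemma m_cong: "f \<in> BL \<Longrightarrow> h \<in> BL \<Longrightarrow> (\<And>x. x \<in> carrier G \<Longrightarrow> f x = h x) \<Longrightarrow> m f = m h"
  using m_mono [of f h] m_mono [of h f] by simp

lemma m_sum: "(\<And>a. a \<in> A \<Longrightarrow> f a \<in> BL) \<Longrightarrow> m (\<lambda>x. \<Sum>a\<in>A. f a x) = (\<Sum>a\<in>A. m (f a))"
proof (induction A rule: infinite_finite_induct)
  case (insert a A)
  then show ?case
    using m_add [of "f a" "\<lambda>x. \<Sum>a\<in>A. f a x"] bounded_luc_sum [of A f] by simp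
qed (use m_const [of 0] in simp_all)

text \<open>This is how a mean yields points of the group: the greedy choice of sample points and,
  through \<open>ex_norm_less\<close>, the expanding estimate for the cocycle depend on it.\<close>

lemma ex_less:
  assumes f: "f \<in> BL" and "m f < c"
  shows "\<exists>x\<in>carrier G. f x < c"
  using m_ge [OF f, of c] assms(2) by (meson not_less)

end

text \<open>Convexity is invoked for positive \<open>a\<close> and \<open>b\<close>; if one of them
  is 0, the claim reduces to t^p \<le> t on [0,1].\<close>

lemma convex_powr_nonneg:
  fixes a b p u v :: real
  assumes p: "1 \<le> p" and "0 \<le> a" "0 \<le> b" "0 \<le> u" "0 \<le> v" "u + v = 1"
  shows "(u * a + v * b) powr p \<le> u * a powr p + v * b powr p"
proof -
  have shrink: "(t * c) powr p \<le> t * c powr p" if "0 \<le> t" "t \<le> 1" "0 \<le> c" for t c :: real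
  proof -
    have "t powr p \<le> t"
      using that p powr_mono' [of 1 p t] by simp
    then show ?thesis
      using that by (simp add: powr_mult mult_right_mono)
  qed
  consider "a = 0" | "b = 0" | "0 < a" "0 < b"
    using assms by force
  then show ?thesis
  proof cases
    case 3
    have u: "u = 1 - v"
      using assms by simp
    show ?thesis
      unfolding u using convex_onD [OF powr_convex [OF p], of v a b] assms 3 by simp
  qed (use shrink [of v b] shrink [of u a] assms p in auto)
qed

section \<open>The p-seminorm of a mean\<close>

definition mean_norm :: "(('g \<Rightarrow> real) \<Rightarrow> real) \<Rightarrow> real \<Rightarrow> ('g \<Rightarrow> 'e::real_normed_vector) \<Rightarrow> real" where
  "mean_norm m p f = m (\<lambda>x. norm (f x) powr p) powr (1 / p)"

context mean
begin

lemma mean_norm_nonneg: "0 \<le> mean_norm m p f"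
  by (simp add: mean_norm_def)

lemma mean_norm_powr: "mean_norm m p f powr p = m (\<lambda>x. norm (f x) powr p)" if "f \<in> BL" "0 < p"
  using m_nonneg [OF norm_powr_bounded_luc [OF that]] that
  by (simp add: mean_norm_def powr_powr)

lemma mean_norm_le_iff:
  assumes "f \<in> BL" "0 < p" "0 \<le> c"
  shows "mean_norm m p f \<le> c \<longleftrightarrow> m (\<lambda>x. norm (f x) powr p) \<le> c powr p"
  using powr_mono2 [of p "mean_norm m p f" c] powr_less_mono2 [of p c "mean_norm m p f"]
    mean_norm_nonneg [of p f] assms
  unfolding mean_norm_powr [OF assms(1,2), symmetric] by linarith

lemma mean_norm_le:
  assumes "f \<in> BL" "0 < p" "0 \<le> c" "\<And>x. x \<in> carrier G \<Longrightarrow> norm (f x) \<le> c"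
  shows "mean_norm m p f \<le> c"
  unfolding mean_norm_le_iff [OF assms(1-3)]
  using assms by (intro m_le norm_powr_bounded_luc powr_mono2) auto

lemma ex_norm_less:
  assumes "f \<in> BL" "0 < p" "mean_norm m p f < c"
  shows "\<exists>x\<in>carrier G. norm (f x) < c"
proof -
  have "m (\<lambda>x. norm (f x) powr p) < c powr p"
    using assms mean_norm_nonneg [of p f] powr_less_mono2 [of p "mean_norm m p f" c]
    by (simp add: mean_norm_powr [symmetric])
  then obtain x where "x \<in> carrier G" "norm (f x) powr p < c powr p"
    using ex_less norm_powr_bounded_luc assms by blast
  then show ?thesis
    using assms mean_norm_nonneg [of p f] powr_mono2 [of p c "norm (f x)"] by (intro bexI [of _ x]) force+
qed

text \<open>Convexity of \<open>t \<mapsto> t\<^sup>p\<close>, applied with weights proportional to \<open>s\<close> and \<open>t\<close>, replaces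
  Hoelder's inequality in the proof of Minkowski's inequality.\<close>

lemma mean_norm_triangle:
  assumes f: "f \<in> BL" and h: "h \<in> BL" and p: "1 \<le> p"
  shows "mean_norm m p (\<lambda>x. f x + h x) \<le> mean_norm m p f + mean_norm m p h"
proof (rule field_le_epsilon)
  fix e :: real assume "0 < e"
  \<comment> \<open>The two halves of \<open>e\<close> make \<open>s\<close> and \<open>t\<close>
    positive even for null vectors, so that division by them is legitimate.\<close>
  define s t where "s = mean_norm m p f + e / 2" and "t = mean_norm m p h + e / 2"
  have st: "0 < s" "0 < t"
    using \<open>0 < e\<close> mean_norm_nonneg [of p f] mean_norm_nonneg [of p h] by (auto simp: s_def t_def)
  define u v where "u = s / (s + t)" and "v = t / (s + t)"
  have uv: "0 \<le> u" "0 \<le> v" "u + v = 1"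
    using st by (auto simp: u_def v_def add_divide_distrib [symmetric])
  have cancel: "(s + t) * u = s" "(s + t) * v = t"
    using st by (auto simp: u_def v_def)
  have fh: "(\<lambda>x. f x + h x) \<in> BL"
    by (rule bounded_luc_add [OF f h])
  note BLs = norm_powr_bounded_luc [OF f, of p] norm_powr_bounded_luc [OF h, of p]
    norm_powr_bounded_luc [OF fh, of p]
  \<comment> \<open>These weights are chosen so that \<open>F * s powr p + H * t powr p\<close>
    collapses to \<open>(s + t) powr p\<close>, because \<open>u + v = 1\<close>.\<close>
  define F H where "F = (s + t) powr p * u / s powr p" and "H = (s + t) powr p * v / t powr p"
  have pointwise: "norm (f x + h x) powr p \<le> F * norm (f x) powr p + H * norm (h x) powr p" for x
  proof -
    have "norm (f x + h x) powr p \<le> (norm (f x) + norm (h x)) powr p"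
      using p by (intro powr_mono2 norm_triangle_ineq) auto
    also have "norm (f x) + norm (h x) = (s + t) * (u * (norm (f x) / s) + v * (norm (h x) / t))"
      using st by (simp add: distrib_left cancel mult.assoc [symmetric])
    also have "\<dots> powr p = (s + t) powr p * (u * (norm (f x) / s) + v * (norm (h x) / t)) powr p"
      using st uv by (simp add: powr_mult)
    also have "\<dots> \<le> (s + t) powr p * (u * (norm (f x) / s) powr p + v * (norm (h x) / t) powr p)"
      using st uv p by (intro mult_left_mono convex_powr_nonneg) auto
    also have "\<dots> = F * norm (f x) powr p + H * norm (h x) powr p"
      using st by (simp add: F_def H_def powr_divide field_simps)
    finally show ?thesis .
  qed
  have "m (\<lambda>x. norm (f x + h x) powr p) \<le> m (\<lambda>x. F * norm (f x) powr p + H * norm (h x) powr p)"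
    using BLs p pointwise by (intro m_mono bounded_luc_add bounded_luc_mult) auto
  also have "\<dots> = F * m (\<lambda>x. norm (f x) powr p) + H * m (\<lambda>x. norm (h x) powr p)"
    using BLs p by (simp add: m_add m_mult bounded_luc_mult)
  also have "\<dots> \<le> F * s powr p + H * t powr p"
  proof (intro add_mono mult_left_mono)
    show "m (\<lambda>x. norm (f x) powr p) \<le> s powr p" "m (\<lambda>x. norm (h x) powr p) \<le> t powr p"
      using st \<open>0 < e\<close> p by (auto simp: mean_norm_le_iff [symmetric] f h s_def t_def)
  qed (use st uv in \<open>auto simp: F_def H_def\<close>)
  also have "\<dots> = (s + t) powr p * (u + v)"
    using st by (simp add: F_def H_def algebra_simps)
  finally have "mean_norm m p (\<lambda>x. f x + h x) \<le> s + t"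
    using st p uv by (simp add: mean_norm_le_iff fh)
  then show "mean_norm m p (\<lambda>x. f x + h x) \<le> mean_norm m p f + mean_norm m p h + e"
    by (simp add: s_def t_def)
qed

lemma seminormed_mean_norm: "seminormed BL (mean_norm m p)" if p: "1 \<le> p"
proof
  fix f :: "'g \<Rightarrow> 'b::real_normed_vector" and c assume f: "f \<in> BL"
  have "m (\<lambda>x. norm (c *\<^sub>R f x) powr p) = \<bar>c\<bar> powr p * m (\<lambda>x. norm (f x) powr p)"
    using m_mult [OF norm_powr_bounded_luc [OF f]] p by (simp add: powr_mult)
  then show "mean_norm m p (c *\<^sub>R f) = \<bar>c\<bar> * mean_norm m p f"
    using m_nonneg [OF norm_powr_bounded_luc [OF f, of p]] p
    by (simp add: mean_norm_def powr_mult powr_powr)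
next
  fix f h :: "'g \<Rightarrow> 'b::real_normed_vector" assume "f \<in> BL" "h \<in> BL"
  then show "mean_norm m p (f + h) \<le> mean_norm m p f + mean_norm m p h"
    using mean_norm_triangle p by (simp add: plus_fun_def)
qed (rule subspace_bounded_luc)

end

text \<open>Indexed by a family rather than by a set of points, so that a sampling sequence may
  visit a point repeatedly; for Folner sets the family is \<open>id\<close>.\<close>

definition average :: "'i set \<Rightarrow> ('i \<Rightarrow> 'g) \<Rightarrow> ('g \<Rightarrow> real) \<Rightarrow> real" where
  "average I x f = (\<Sum>i\<in>I. f (x i)) / card I"

lemma (in top_group) mean_average:
  assumes "finite I" "I \<noteq> {}" "x ` I \<subseteq> carrier G"
  shows "mean G T (average I x)"
  by unfold_locales
    (use assms in \<open>auto simp: average_def sum.distrib add_divide_distrib sum_distrib_left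
      intro!: divide_nonneg_nonneg sum_nonneg\<close>)

text \<open>Greedy choice of the points: since the mean of \<open>\<Sum>a. s a * (f a x - m (f a))\<close> is \<open>0\<close>, a point
  can be chosen that makes the step almost orthogonal to the accumulated error \<open>s\<close>, so that the
  squared length of the error grows only linearly.\<close>

lemma (in mean) averages_tendsto_mean:
  assumes "finite A" and f: "\<And>a. a \<in> A \<Longrightarrow> f a \<in> BL"
  shows "\<exists>x. range x \<subseteq> carrier G \<and> (\<forall>a\<in>A. (\<lambda>n. average {..<n} x (f a)) \<longlonglongrightarrow> m (f a))"
proof -
  define v where "v a x = f a x - m (f a)" for a x
  have v: "v a \<in> BL" if "a \<in> A" for a
    unfolding v_def using that by (intro bounded_luc_diff f bounded_luc_const)
  have m_v: "m (v a) = 0" if "a \<in> A" for a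
    unfolding v_def using that by (simp add: m_diff f bounded_luc_const m_const)
  have "\<exists>x\<in>carrier G. (\<Sum>a\<in>A. s a * v a x) < 1" for s
  proof (rule ex_less)
    show "(\<lambda>x. \<Sum>a\<in>A. s a * v a x) \<in> BL"
      by (intro bounded_luc_sum bounded_luc_mult v)
    show "m (\<lambda>x. \<Sum>a\<in>A. s a * v a x) < 1"
      by (simp add: m_sum bounded_luc_mult v m_mult m_v)
  qed
  then obtain pick where pick: "\<And>s. pick s \<in> carrier G" "\<And>s. (\<Sum>a\<in>A. s a * v a (pick s)) < 1"
    by metis
  define s where "s = rec_nat (\<lambda>_. 0) (\<lambda>_ s a. s a + v a (pick s))"
  define x where "x n = pick (s n)" for n
  have s_0: "s 0 a = 0" and s_Suc: "s (Suc n) a = s n a + v a (x n)" for n a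
    by (simp_all add: s_def x_def)
  have s_eq: "s n a = (\<Sum>j<n. v a (x j))" for n a
    by (induction n) (simp_all add: s_0 s_Suc)
  have "\<exists>c. \<forall>y\<in>carrier G. \<bar>v a y\<bar> \<le> c" if "a \<in> A" for a
    using bounded_lucE [OF v [OF that]] by (metis real_norm_def)
  then obtain C where C: "\<And>a y. a \<in> A \<Longrightarrow> y \<in> carrier G \<Longrightarrow> \<bar>v a y\<bar> \<le> C a"
    by metis
  \<comment> \<open>One step adds twice the inner product, hence less than 2, and the squared length
    of the new vector. Dividing the error \<open>s n\<close> by \<open>n\<close> then gives the rate
    sqrt(K/n).\<close>
  define K where "K = 2 + (\<Sum>a\<in>A. (C a)\<^sup>2)"
  have growth: "(\<Sum>a\<in>A. (s n a)\<^sup>2) \<le> n * K" for n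
  proof (induction n)
    case (Suc n)
    have "(\<Sum>a\<in>A. (s (Suc n) a)\<^sup>2) =
        (\<Sum>a\<in>A. (s n a)\<^sup>2) + 2 * (\<Sum>a\<in>A. s n a * v a (x n)) + (\<Sum>a\<in>A. (v a (x n))\<^sup>2)"
      unfolding s_Suc power2_sum sum.distrib sum_distrib_left by (simp add: mult.assoc)
    moreover have "(\<Sum>a\<in>A. (v a (x n))\<^sup>2) \<le> (\<Sum>a\<in>A. (C a)\<^sup>2)"
      using C pick(1) by (intro sum_mono) (metis abs_ge_zero power2_abs power_mono x_def)
    ultimately show ?case
      using Suc pick(2) [of "s n"] by (simp add: x_def K_def algebra_simps)
  qed (simp add: s_0)
  have "(\<lambda>n. average {..<n} x (f a)) \<longlonglongrightarrow> m (f a)" if a: "a \<in> A" for a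
  proof -
    have "\<bar>average {..<n} x (f a) - m (f a)\<bar> \<le> sqrt (K / n)" if "0 < n" for n
    proof -
      have "average {..<n} x (f a) - m (f a) = s n a / n"
        using that by (simp add: average_def s_eq v_def sum_subtractf field_simps)
      moreover have "(s n a)\<^sup>2 \<le> n * K"
        using growth [of n] member_le_sum [OF a, of "\<lambda>a. (s n a)\<^sup>2"] \<open>finite A\<close> by simp
      then have "(s n a / n)\<^sup>2 \<le> K / n"
        using that by (simp add: power_divide power2_eq_square field_simps)
      ultimately show ?thesis
        by (metis real_sqrt_abs real_sqrt_le_iff)
    qed
    then have "\<forall>\<^sub>F n in sequentially. norm (average {..<n} x (f a) - m (f a)) \<le> sqrt (K / n)"
      by (intro eventually_sequentiallyI [of 1]) simp
    moreover have "(\<lambda>n. sqrt (K / real n)) \<longlonglongrightarrow> 0"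
      using tendsto_real_sqrt [OF lim_const_over_n [of K]] by simp
    ultimately have "(\<lambda>n. average {..<n} x (f a) - m (f a)) \<longlonglongrightarrow> 0"
      by (rule Lim_null_comparison)
    then show ?thesis
      by (simp add: LIM_zero_iff)
  qed
  moreover have "range x \<subseteq> carrier G"
    using pick(1) by (auto simp: x_def)
  ultimately show ?thesis
    by blast
qed

section \<open>Amenability\<close>

text \<open>Induction on the cardinality of \<open>A\<close>. If some nonempty proper
  \<open>J\<close> has exactly as many neighbours as elements, \<open>J\<close> and its complement
  are matched separately; otherwise there is slack everywhere and one pair can be matched
  arbitrarily.\<close>

lemma hall_marriage:
  assumes "finite A" "\<And>a. a \<in> A \<Longrightarrow> finite (N a)" "\<And>J. J \<subseteq> A \<Longrightarrow> card J \<le> card (\<Union>(N ` J))"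
  shows "\<exists>f. inj_on f A \<and> (\<forall>a\<in>A. f a \<in> N a)"
  using assms
proof (induction "card A" arbitrary: A N rule: less_induct)
  case less
  note finA = less.prems(1) and finN = less.prems(2) and hall = less.prems(3)
  have finUN: "finite (\<Union>(N ` J))" if "J \<subseteq> A" for J
    using that finA finN by (intro finite_UN_I) (auto intro: finite_subset)
  show ?case
  proof (cases "\<exists>J. J \<subset> A \<and> J \<noteq> {} \<and> card (\<Union>(N ` J)) = card J")
    case True
    then obtain J where J: "J \<subset> A" "J \<noteq> {}" "card (\<Union>(N ` J)) = card J"
      by blast
    have finJ: "finite J"
      using J finA by (meson finite_subset psubset_imp_subset)
    have "\<exists>f. inj_on f J \<and> (\<forall>a\<in>J. f a \<in> N a)"
    proof (rule less.hyps)
      show "card J < card A"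
        using J finA by (simp add: psubset_card_mono)
      show "card I \<le> card (\<Union>(N ` I))" if "I \<subseteq> J" for I
        using that J by (intro hall) auto
    qed (use finJ J finN in auto)
    then obtain f where f: "inj_on f J" "\<And>a. a \<in> J \<Longrightarrow> f a \<in> N a"
      by blast
    \<comment> \<open>Forbidding the neighbours of \<open>J\<close> keeps the hypothesis for the
      complement: apply it to \<open>I \<union> J\<close> and subtract the equality for
      \<open>J\<close>.\<close>
    define M where "M a = N a - \<Union>(N ` J)" for a
    have "\<exists>f. inj_on f (A - J) \<and> (\<forall>a\<in>A - J. f a \<in> M a)"
    proof (rule less.hyps)
      show "card (A - J) < card A"
        using J finA by (intro psubset_card_mono) auto
      show "card I \<le> card (\<Union>(M ` I))" if I: "I \<subseteq> A - J" for I
      proof -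
        have "\<Union>(M ` I) = \<Union>(N ` (I \<union> J)) - \<Union>(N ` J)"
          by (auto simp: M_def)
        then have "card (\<Union>(M ` I)) = card (\<Union>(N ` (I \<union> J))) - card (\<Union>(N ` J))"
          using J finUN [of J] by (simp add: card_Diff_subset)
        moreover have "card (I \<union> J) \<le> card (\<Union>(N ` (I \<union> J)))"
          using I J by (intro hall) auto
        moreover have "card (I \<union> J) = card I + card J"
          using I finJ finA by (intro card_Un_disjoint) (auto intro: finite_subset)
        ultimately show ?thesis
          using J by simp
      qed
    qed (use finA finN in \<open>auto simp: M_def\<close>)
    then obtain h where h: "inj_on h (A - J)" "\<And>a. a \<in> A - J \<Longrightarrow> h a \<in> M a"
      by blast
    have disjoint: "f a \<noteq> h b" if "a \<in> J" "b \<in> A - J" for a b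
      using f(2) [OF that(1)] h(2) [OF that(2)] that(1) by (auto simp: M_def)
    have "inj_on (\<lambda>a. if a \<in> J then f a else h a) A"
    proof (rule inj_onI)
      fix a b assume "a \<in> A" "b \<in> A" "(if a \<in> J then f a else h a) = (if b \<in> J then f b else h b)"
      then show "a = b"
        using disjoint [of a b] disjoint [of b a] inj_onD [OF f(1), of a b] inj_onD [OF h(1), of a b]
        by (auto split: if_splits)
    qed
    moreover have "\<forall>a\<in>A. (if a \<in> J then f a else h a) \<in> N a"
      using f h by (auto simp: M_def)
    ultimately show ?thesis
      by (intro exI [of _ "\<lambda>a. if a \<in> J then f a else h a"] conjI)
  next
    case False
    show ?thesis
    proof (cases "A = {}")
      case nonempty: False
      then obtain a where a: "a \<in> A"
        by blast
      have "card {a} \<le> card (\<Union>(N ` {a}))"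
        using a by (intro hall) auto
      then have "N a \<noteq> {}"
        by auto
      then obtain b where b: "b \<in> N a"
        by blast
      have "\<exists>f. inj_on f (A - {a}) \<and> (\<forall>x\<in>A - {a}. f x \<in> N x - {b})"
      proof (rule less.hyps)
        show "card (A - {a}) < card A"
          using a finA by (intro psubset_card_mono) auto
        show "card I \<le> card (\<Union>x\<in>I. N x - {b})" if I: "I \<subseteq> A - {a}" for I
        proof (cases "I = {}")
          case nonempty_I: False
          \<comment> \<open>No set is tight here, so \<open>I\<close> has a surplus neighbour, and
            removing \<open>b\<close> costs at most one.\<close>
          have "card I \<le> card (\<Union>(N ` I))"
            using I by (intro hall) auto
          moreover have "card (\<Union>(N ` I)) \<noteq> card I"
            using False I a nonempty_I by blast
          moreover have "(\<Union>x\<in>I. N x - {b}) = \<Union>(N ` I) - {b}"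
            by auto
          moreover have "card (\<Union>(N ` I)) - 1 \<le> card (\<Union>(N ` I) - {b})"
            by (simp add: card_Diff_singleton_if)
          ultimately show ?thesis
            by simp
        qed simp
      qed (use finA finN in auto)
      then obtain f where f: "inj_on f (A - {a})" "\<And>x. x \<in> A - {a} \<Longrightarrow> f x \<in> N x - {b}"
        by blast
      have "inj_on (f(a := b)) A"
        using f by (auto simp: inj_on_def)
      moreover have "\<forall>x\<in>A. (f(a := b)) x \<in> N x"
        using f b by auto
      ultimately show ?thesis
        by blast
    qed simp
  qed
qed

section \<open>Almost invariant finite sets and cluster points of means\<close>

context top_group
begin

text \<open>The tube lemma around K x {1} for the map (z, v) \<mapsto> inv z v z. It serves to trade
  closeness of the form z inv x for closeness of the form inv x y, uniformly over
  \<open>K\<close>.\<close>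

lemma compact_conjugation:
  assumes K: "compactin T K" and W: "openin T W" "\<one> \<in> W"
  obtains V where "openin T V" "\<one> \<in> V" "\<And>z v. z \<in> K \<Longrightarrow> v \<in> V \<Longrightarrow> inv z \<otimes> v \<otimes> z \<in> W"
proof -
  define W' where "W' = {q \<in> topspace (prod_topology T T). inv (fst q) \<otimes> snd q \<otimes> fst q \<in> W}"
  have KG: "K \<subseteq> carrier G"
    using compactin_subset_topspace [OF K] by simp
  have "openin (prod_topology T T) W'"
    unfolding W'_def
    by (intro openin_continuous_map_preimage [OF _ W(1)] continuous_group_intros
        continuous_map_fst continuous_map_snd)
  moreover have "K \<times> {\<one>} \<subseteq> W'"
    using KG W(2) by (auto simp: W'_def)
  ultimately obtain U V where "openin T V" "\<one> \<in> V" "K \<subseteq> U" "U \<times> V \<subseteq> W'"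
    using tube_lemma_left [of T T W' K \<one>] K by auto
  moreover from this have "(z, v) \<in> W'" if "z \<in> K" "v \<in> V" for z v
    using that by blast
  ultimately show thesis
    by (intro that [of V]) (auto simp: W'_def)
qed

lemma division_neighbourhood:
  assumes V: "openin T V" "\<one> \<in> V"
  obtains U where "openin T U" "\<one> \<in> U" "\<And>u v. u \<in> U \<Longrightarrow> v \<in> U \<Longrightarrow> u \<otimes> inv v \<in> V"
proof -
  define W where "W = {q \<in> topspace (prod_topology T T). fst q \<otimes> inv (snd q) \<in> V}"
  have "openin (prod_topology T T) W"
    unfolding W_def
    by (intro openin_continuous_map_preimage [OF _ V(1)] continuous_group_intros
        continuous_map_fst continuous_map_snd)
  moreover have "(\<one>, \<one>) \<in> W"
    using V by (auto simp: W_def)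
  ultimately obtain U U' where "openin T U" "openin T U'" "\<one> \<in> U" "\<one> \<in> U'" "U \<times> U' \<subseteq> W"
    unfolding openin_prod_topology_alt by meson
  moreover from this have "(u, v) \<in> W" if "u \<in> U" "v \<in> U'" for u v
    using that by blast
  ultimately show thesis
    by (intro that [of "U \<inter> U'"]) (auto simp: W_def)
qed

text \<open>If \<open>F\<close> is a net of minimal cardinality, then so is \<open>F g\<close>, and minimality is exactly Hall's
  condition for matching the two nets along pairs of points with a common neighbour.\<close>

lemma folner_set:
  assumes K: "subgroup K G" "compactin T K" and W: "openin T W" "\<one> \<in> W"
  obtains F where "finite F" "F \<noteq> {}" "F \<subseteq> K"
    "\<And>g. g \<in> K \<Longrightarrow> \<exists>\<beta>. bij_betw \<beta> F F \<and> (\<forall>x\<in>F. inv (x \<otimes> g) \<otimes> \<beta> x \<in> W)"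
proof -
  interpret K: subgroup K G
    by (rule K)
  obtain V where V: "openin T V" "\<one> \<in> V" "\<And>z v. z \<in> K \<Longrightarrow> v \<in> V \<Longrightarrow> inv z \<otimes> v \<otimes> z \<in> W"
    using compact_conjugation [OF K(2) W] by blast
  obtain U where U: "openin T U" "\<one> \<in> U" "\<And>u v. u \<in> U \<Longrightarrow> v \<in> U \<Longrightarrow> u \<otimes> inv v \<in> V"
    using division_neighbourhood [OF V(1,2)] by blast
  \<comment> \<open>Closeness is measured by \<open>z \<otimes> inv x\<close>, which simultaneous
    right translation leaves unchanged; this is why the translate \<open>F'\<close> below is again a
    net.\<close>
  define net where "net F \<longleftrightarrow> finite F \<and> F \<subseteq> K \<and> (\<forall>z\<in>K. \<exists>x\<in>F. z \<otimes> inv x \<in> U)" for F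
  have "\<exists>F. net F"
  proof -
    define B where "B x = {z \<in> carrier G. z \<otimes> inv x \<in> U}" for x
    have openB: "openin T (B x)" if "x \<in> K" for x
      unfolding B_def using U(1) K.mem_carrier [OF that]
      by (intro open_preimage continuous_group_intros) auto
    have "x \<in> B x" if "x \<in> K" for x
      using U(2) K.mem_carrier [OF that] by (simp add: B_def)
    then have "K \<subseteq> \<Union>(B ` K)"
      by blast
    then obtain \<F> where \<F>: "finite \<F>" "\<F> \<subseteq> B ` K" "K \<subseteq> \<Union>\<F>"
      using compactinD [OF K(2), of "B ` K"] openB by blast
    obtain F where "F \<subseteq> K" "finite F" "\<F> = B ` F"
      using finite_subset_image [OF \<F>(1,2)] by blast
    then have "net F"
      using \<F>(3) by (auto simp: net_def B_def)
    then show ?thesis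
      by blast
  qed
  then obtain F where F: "net F" and least: "\<And>F'. net F' \<Longrightarrow> card F \<le> card F'"
    using ex_has_least_nat [of net _ card] by blast
  have finF: "finite F" and FK: "F \<subseteq> K" and cover: "\<And>z. z \<in> K \<Longrightarrow> \<exists>x\<in>F. z \<otimes> inv x \<in> U"
    using F by (auto simp: net_def)
  show thesis
  proof (rule that [OF finF _ FK])
    show "F \<noteq> {}"
      using cover [OF K.one_closed] by blast
    fix g assume g: "g \<in> K"
    have inj: "inj_on (\<lambda>x. x \<otimes> g) F"
      using FK g by (intro inj_onI) (metis K.mem_carrier right_cancel subsetD)
    define F' where "F' = (\<lambda>x. x \<otimes> g) ` F"
    have F'K: "F' \<subseteq> K" and finF': "finite F'" and cardF': "card F' = card F"
      using FK g finF inj by (auto simp: F'_def card_image)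
    have cover': "\<exists>y\<in>F'. z \<otimes> inv y \<in> U" if z: "z \<in> K" for z
    proof -
      obtain x where x: "x \<in> F" "z \<otimes> inv g \<otimes> inv x \<in> U"
        using cover [of "z \<otimes> inv g"] z g by auto
      then have "z \<otimes> inv (x \<otimes> g) \<in> U"
        using z g FK by (simp add: inv_mult_group m_assoc subsetD)
      then show ?thesis
        using x by (auto simp: F'_def)
    qed
    define N where "N y = {w \<in> F. \<exists>z\<in>K. z \<otimes> inv y \<in> U \<and> z \<otimes> inv w \<in> U}" for y
    have "\<exists>f. inj_on f F' \<and> (\<forall>y\<in>F'. f y \<in> N y)"
    proof (rule hall_marriage [OF finF'])
      show "finite (N y)" for y
        using finF by (simp add: N_def)
      fix J assume J: "J \<subseteq> F'"
      \<comment> \<open>Each \<open>z\<close> is close to some \<open>y\<close> in \<open>F'\<close>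
        and some \<open>x\<close> in \<open>F\<close>. If \<open>y\<close> belongs to
        \<open>J\<close>, then \<open>z\<close> witnesses that \<open>x\<close> lies in
        \<open>N y\<close>, so \<open>x\<close> can replace \<open>y\<close>. Minimality of
        \<open>F\<close> then reads |F| \<le> |F| - |J| + |N(J)|.\<close>
      have "net ((F' - J) \<union> \<Union>(N ` J))"
        unfolding net_def
      proof (intro conjI ballI)
        show "finite ((F' - J) \<union> \<Union>(N ` J))"
          using finF' finF J by (auto simp: N_def intro: finite_subset)
        show "(F' - J) \<union> \<Union>(N ` J) \<subseteq> K"
          using F'K FK by (auto simp: N_def)
        fix z assume z: "z \<in> K"
        obtain y x where "y \<in> F'" "z \<otimes> inv y \<in> U" "x \<in> F" "z \<otimes> inv x \<in> U"
          using cover [OF z] cover' [OF z] by blast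
        then show "\<exists>x\<in>(F' - J) \<union> \<Union>(N ` J). z \<otimes> inv x \<in> U"
          using z by (cases "y \<in> J") (auto simp: N_def)
      qed
      then have "card F \<le> card ((F' - J) \<union> \<Union>(N ` J))"
        by (rule least)
      also have "\<dots> \<le> card (F' - J) + card (\<Union>(N ` J))"
        by (rule card_Un_le)
      also have "card (F' - J) = card F - card J"
        using J finF' cardF' by (simp add: card_Diff_subset finite_subset)
      finally show "card J \<le> card (\<Union>(N ` J))"
        using card_mono [OF finF' J] cardF' by simp
    qed
    then obtain f where f: "inj_on f F'" "\<And>y. y \<in> F' \<Longrightarrow> f y \<in> N y"
      by blast
    have "inj_on (\<lambda>x. f (x \<otimes> g)) F"
      using comp_inj_on [OF inj, of f] f(1) by (simp add: F'_def o_def)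
    moreover have "(\<lambda>x. f (x \<otimes> g)) ` F \<subseteq> F"
      using f(2) by (auto simp: F'_def N_def)
    ultimately have "bij_betw (\<lambda>x. f (x \<otimes> g)) F F"
      using endo_inj_surj [OF finF] by (simp add: bij_betw_def)
    moreover have "inv (x \<otimes> g) \<otimes> f (x \<otimes> g) \<in> W" if x: "x \<in> F" for x
    proof -
      obtain z where z: "z \<in> K" "z \<otimes> inv (x \<otimes> g) \<in> U" "z \<otimes> inv (f (x \<otimes> g)) \<in> U"
        and w: "f (x \<otimes> g) \<in> F"
        using f(2) [of "x \<otimes> g"] x by (auto simp: F'_def N_def)
      have "x \<in> carrier G" "g \<in> carrier G" "z \<in> carrier G" "f (x \<otimes> g) \<in> carrier G"
        using x g z w FK by auto
      \<comment> \<open>With u = z inv (x g) and v = z inv (f (x g)) both in \<open>U\<close>, the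
        product u inv v lies in \<open>V\<close>; conjugation by \<open>z\<close> cancels
        \<open>z\<close> and lands in \<open>W\<close>.\<close>
      then have "inv z \<otimes> (z \<otimes> inv (x \<otimes> g) \<otimes> inv (z \<otimes> inv (f (x \<otimes> g)))) \<otimes> z
          = inv (x \<otimes> g) \<otimes> f (x \<otimes> g)"
        by (simp add: inv_mult_group m_assoc)
      then show ?thesis
        using V(3) [OF z(1) U(3) [OF z(2,3)]] by simp
    qed
    ultimately show "\<exists>\<beta>. bij_betw \<beta> F F \<and> (\<forall>x\<in>F. inv (x \<otimes> g) \<otimes> \<beta> x \<in> W)"
      by (intro exI [of _ "\<lambda>x. f (x \<otimes> g)"]) blast
  qed
qed

text \<open>The sum of \<open>f\<close> over \<open>F\<close> may be reindexed by the permutation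
  \<open>\<beta>\<close>, after which the two sums are compared term by term.\<close>

lemma average_almost_invariant:
  fixes f :: "'g \<Rightarrow> real"
  assumes F: "F \<noteq> {}" "finite F" "F \<subseteq> carrier G" and g: "g \<in> carrier G"
    and \<beta>: "bij_betw \<beta> F F" "\<And>x. x \<in> F \<Longrightarrow> inv (x \<otimes> g) \<otimes> \<beta> x \<in> W"
    and f: "\<And>x y. x \<in> carrier G \<Longrightarrow> y \<in> carrier G \<Longrightarrow> inv x \<otimes> y \<in> W \<Longrightarrow> dist (f x) (f y) < e"
  shows "\<bar>average F id (\<lambda>x. f (x \<otimes> g)) - average F id f\<bar> \<le> e"
proof -
  have "(\<Sum>x\<in>F. f (x \<otimes> g)) - (\<Sum>x\<in>F. f x) = (\<Sum>x\<in>F. f (x \<otimes> g) - f (\<beta> x))"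
    using sum.reindex_bij_betw [OF \<beta>(1), of f] by (simp add: sum_subtractf)
  also have "\<bar>\<dots>\<bar> \<le> (\<Sum>x\<in>F. e)"
  proof (rule order_trans [OF sum_abs sum_mono])
    fix x assume x: "x \<in> F"
    moreover have "\<beta> x \<in> F"
      using x \<beta>(1) bij_betwE by blast
    ultimately show "\<bar>f (x \<otimes> g) - f (\<beta> x)\<bar> \<le> e"
      using F(3) g f [OF _ _ \<beta>(2) [OF x]] by (force simp: dist_real_def)
  qed
  finally have "\<bar>(\<Sum>x\<in>F. f (x \<otimes> g)) - (\<Sum>x\<in>F. f x)\<bar> \<le> card F * e"
    by simp
  moreover have "0 < card F"
    using F by (simp add: card_gt_0_iff)
  ultimately show ?thesis
    by (simp add: average_def diff_divide_distrib [symmetric] abs_divide field_simps)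
qed

text \<open>On each bounded function all \<open>M n\<close> are bounded by its supremum norm, so
  they lie in a product of compact intervals. The laws of a mean are equations and inequalities
  between finitely many coordinates and pass to a cluster point.\<close>

lemma cluster_mean:
  assumes M: "\<And>n::nat. mean G T (M n)"
  obtains m where "mean G T m"
    "\<And>f h. f \<in> BL \<Longrightarrow> h \<in> BL \<Longrightarrow> (\<lambda>n. M n f - M n h) \<longlonglongrightarrow> 0 \<Longrightarrow> m f = m h"
proof -
  have "\<exists>c\<ge>0. \<forall>n. \<bar>M n f\<bar> \<le> c" if f: "f \<in> BL" for f
  proof -
    obtain c where c: "0 < c" "\<And>x. x \<in> carrier G \<Longrightarrow> norm (f x) \<le> c"
      using f by (rule bounded_lucE) blast
    have "\<bar>M n f\<bar> \<le> c" for n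
      using mean.m_abs_diff_le [OF M [of n] f bounded_luc_const [of 0], of c] mean.m_const [OF M, of n 0] c
      by simp
    then show ?thesis
      using c(1) by (intro exI [of _ c]) simp
  qed
  then obtain c where c: "\<And>f. f \<in> BL \<Longrightarrow> 0 \<le> c f" "\<And>f n. f \<in> BL \<Longrightarrow> \<bar>M n f\<bar> \<le> c f"
    by metis
  define C where "C f = (if f \<in> BL then c f else 0)" for f
  \<comment> \<open>Outside \<open>BL\<close> nothing bounds \<open>M n\<close>; the value 0 there
    brings every \<open>L n\<close> into the compact product.\<close>
  define L where "L n f = (if f \<in> BL then M n f else 0)" for n f
  define S where "S = PiE UNIV (\<lambda>f. {- C f..C f})"
  have "compactin (product_topology (\<lambda>_. euclidean) UNIV) S"
    unfolding S_def compactin_PiE by simp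
  then have "compact S"
    by (simp add: euclidean_product_topology)
  moreover have "L n \<in> S" for n
    using c by (auto simp: S_def L_def C_def abs_le_iff minus_le_iff)
  then have "\<forall>\<^sub>F k in filtermap L sequentially. k \<in> S"
    by (simp add: eventually_filtermap)
  ultimately obtain m where m: "inf (nhds m) (filtermap L sequentially) \<noteq> bot"
    unfolding compact_filter by (metis filtermap_bot_iff sequentially_bot)
  \<comment> \<open>\<open>\<Phi>\<close> plays the part of an ultrafilter: it is proper, converges
    to \<open>m\<close> and is finer than the image of \<open>sequentially\<close>, so differences
    tending to 0 still do so along it. A subsequence converging at every function need not
    exist.\<close>
  define \<Phi> where "\<Phi> = inf (nhds m) (filtermap L sequentially)"
  have nonbot: "\<Phi> \<noteq> bot" and \<Phi>: "\<Phi> \<le> nhds m" "\<Phi> \<le> filtermap L sequentially"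
    using m by (simp_all add: \<Phi>_def)
  have lim: "((\<lambda>k. k f) \<longlongrightarrow> m f) \<Phi>" for f
  proof -
    have "filterlim (\<lambda>k. k f) (nhds (m f)) (nhds m)"
    proof (rule topological_tendstoI)
      fix U :: "real set" assume "open U" "m f \<in> U"
      moreover from this have "open ((\<lambda>k::('g \<Rightarrow> real) \<Rightarrow> real. k f) -` U)"
        by (intro open_vimage continuous_on_product_coordinates)
      ultimately show "\<forall>\<^sub>F k in nhds m. k f \<in> U"
        unfolding eventually_nhds by blast
    qed
    then show ?thesis
      using \<Phi>(1) by (rule filterlim_mono [OF _ order_refl])
  qed
  have ev: "\<forall>\<^sub>F k in \<Phi>. P k" if "\<And>n. P (L n)" for P
    using that by (intro filter_leD [OF \<Phi>(2)]) (simp add: eventually_filtermap)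
  show thesis
  proof (rule that [of m])
    show "mean G T m"
    proof (intro mean.intro top_group_axioms mean_axioms.intro)
      fix f h :: "'g \<Rightarrow> real" and a :: real
      assume f: "f \<in> BL"
      have "\<forall>\<^sub>F k in \<Phi>. k (\<lambda>x. a * f x) = a * k f"
        by (rule ev) (simp add: L_def f bounded_luc_mult mean.m_mult [OF M])
      then have "((\<lambda>k. a * k f) \<longlongrightarrow> m (\<lambda>x. a * f x)) \<Phi>"
        using lim [of "\<lambda>x. a * f x"] by (simp add: filterlim_cong)
      then show "m (\<lambda>x. a * f x) = a * m f"
        using tendsto_unique [OF nonbot] tendsto_mult_left [OF lim] by blast
      show "0 \<le> m f" if "\<And>x. x \<in> carrier G \<Longrightarrow> 0 \<le> f x"
        using that by (intro tendsto_lowerbound [OF lim _ nonbot] ev)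
          (simp add: L_def f mean.m_nonneg [OF M])
      assume h: "h \<in> BL"
      have "\<forall>\<^sub>F k in \<Phi>. k (\<lambda>x. f x + h x) = k f + k h"
        by (rule ev) (simp add: L_def f h bounded_luc_add mean.m_add [OF M])
      then have "((\<lambda>k. k f + k h) \<longlongrightarrow> m (\<lambda>x. f x + h x)) \<Phi>"
        using lim [of "\<lambda>x. f x + h x"] by (simp add: filterlim_cong)
      then show "m (\<lambda>x. f x + h x) = m f + m h"
        using tendsto_unique [OF nonbot] tendsto_add [OF lim lim] by blast
    next
      have "\<forall>\<^sub>F k in \<Phi>. k (\<lambda>x. 1) = 1"
        by (rule ev) (simp add: L_def bounded_luc_const mean.m_one [OF M])
      then have "((\<lambda>k. 1) \<longlongrightarrow> m (\<lambda>x. 1)) \<Phi>"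
        using lim [of "\<lambda>x. 1"] by (rule Lim_transform_eventually [rotated])
      then show "m (\<lambda>x. 1) = 1"
        by (rule tendsto_unique [OF nonbot tendsto_const, symmetric])
    qed
    fix f h :: "'g \<Rightarrow> real"
    assume "f \<in> BL" "h \<in> BL" "(\<lambda>n. M n f - M n h) \<longlonglongrightarrow> 0"
    then have "filterlim (\<lambda>k. k f - k h) (nhds 0) (filtermap L sequentially)"
      by (simp add: filterlim_filtermap L_def)
    then have "((\<lambda>k. k f - k h) \<longlongrightarrow> 0) \<Phi>"
      using \<Phi>(2) by (rule filterlim_mono [OF _ order_refl])
    then have "m f - m h = 0"
      using tendsto_unique [OF nonbot] tendsto_diff [OF lim lim] by blast
    then show "m f = m h"
      by simp
  qed
qed

end

text \<open>If \<open>y\<close> in \<open>L\<close> is close to \<open>g\<close>, then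
  \<open>f (x \<otimes> y)\<close> and \<open>f (x \<otimes> g)\<close> are close uniformly in
  \<open>x\<close>, since inv (x y) (x g) = inv y g; a mean does not increase uniform
  distance.\<close>

lemma (in mean) invariant_if_dense:
  assumes L: "L \<subseteq> carrier G" "Abstract_Topology.closure_of T L = carrier G"
    and inv: "\<And>g f. g \<in> L \<Longrightarrow> f \<in> BL \<Longrightarrow> m (\<lambda>x. f (x \<otimes> g)) = m f"
    and g: "g \<in> carrier G" and f: "f \<in> BL"
  shows "m (\<lambda>x. f (x \<otimes> g)) = m f"
proof -
  have "\<bar>m (\<lambda>x. f (x \<otimes> g)) - m f\<bar> \<le> e" if "0 < e" for e
  proof -
    have "left_uniformly_continuous G T dist f"
      using f by (simp add: bounded_luc_def)
    then obtain U where U: "openin T U" "\<one> \<in> U"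
      "\<And>x y. x \<in> carrier G \<Longrightarrow> y \<in> carrier G \<Longrightarrow> inv x \<otimes> y \<in> U \<Longrightarrow> dist (f x) (f y) < e"
      using \<open>0 < e\<close> by (rule left_uniformly_continuousE) blast
    define V where "V = {y \<in> carrier G. inv y \<otimes> g \<in> U}"
    have "openin T V"
      unfolding V_def using U(1) g by (intro open_preimage continuous_group_intros) auto
    moreover have "g \<in> V"
      using U(2) g by (simp add: V_def)
    moreover have "g \<in> Abstract_Topology.closure_of T L"
      using g L by simp
    ultimately have "\<exists>y. y \<in> L \<and> y \<in> V"
      unfolding in_closure_of by blast
    then obtain y where y: "y \<in> L" "inv y \<otimes> g \<in> U"
      by (auto simp: V_def)
    have "dist (f (x \<otimes> y)) (f (x \<otimes> g)) < e" if "x \<in> carrier G" for x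
      using that y L g U(3) [of "x \<otimes> y" "x \<otimes> g"] by (auto simp: inv_mult_group m_assoc)
    then have "\<bar>m (\<lambda>x. f (x \<otimes> g)) - m (\<lambda>x. f (x \<otimes> y))\<bar> \<le> e"
      using f g y L
      by (intro m_abs_diff_le bounded_luc_right_translate) (auto simp: dist_real_def abs_minus_commute less_imp_le)
    then show ?thesis
      using inv [OF y(1) f] by simp
  qed
  then show ?thesis
    by (metis abs_le_zero_iff eq_iff_diff_eq_0 field_le_epsilon add_0)
qed

text \<open>Metrizability gives a sequence of balls \<open>W n\<close> shrinking to the identity, so
  one sequence of Folner sets, the n-th in \<open>K n\<close> with tolerance \<open>W n\<close>,
  eventually serves every \<open>g\<close> in the union and every \<open>f\<close>.\<close>

lemma (in top_group) ex_invariant_mean_compact_chain: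
  assumes "completely_metrizable_space T" "compact_chain_dense G T"
  shows "\<exists>m. mean G T m \<and> (\<forall>g\<in>carrier G. \<forall>f\<in>BL. m (\<lambda>x. f (x \<otimes> g)) = m f)"
proof -
  obtain X d where "Metric_space X d" and T: "T = Metric_space.mtopology X d"
    using assms(1) unfolding completely_metrizable_space_def by blast
  then interpret X: Metric_space X d
    by simp
  have X: "X = carrier G"
    using topspace_T by (simp add: T)
  obtain K where K: "\<And>n. subgroup (K n) G" "\<And>n. compactin T (K n)" "\<And>n. K n \<subseteq> K (Suc n)"
    and dense: "Abstract_Topology.closure_of T (\<Union>n. K n) = carrier G"
    using assms(2) unfolding compact_chain_dense_def by blast
  define W where "W n = X.mball \<one> (inverse (Suc n))" for n
  have "\<one> \<in> X"
    using one_closed by (simp add: X)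
  then have W: "openin T (W n)" "\<one> \<in> W n" for n
    by (simp_all add: W_def T)
  have "\<exists>F. finite F \<and> F \<noteq> {} \<and> F \<subseteq> K n \<and>
      (\<forall>g\<in>K n. \<exists>\<beta>. bij_betw \<beta> F F \<and> (\<forall>x\<in>F. inv (x \<otimes> g) \<otimes> \<beta> x \<in> W n))" for n
    using folner_set [OF K(1,2) W] by metis
  then obtain F where F: "\<And>n. finite (F n)" "\<And>n. F n \<noteq> {}" "\<And>n. F n \<subseteq> K n"
    "\<And>n g. g \<in> K n \<Longrightarrow> \<exists>\<beta>. bij_betw \<beta> (F n) (F n) \<and> (\<forall>x\<in>F n. inv (x \<otimes> g) \<otimes> \<beta> x \<in> W n)"
    by metis
  have KG: "K n \<subseteq> carrier G" for n
    using subgroup.subset K(1) by blast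
  have FG: "F n \<subseteq> carrier G" for n
    using F(3) KG by blast
  have avg: "mean G T (average (F n) id)" for n
    using F FG by (intro mean_average) auto
  obtain m where m: "mean G T m" and eq: "\<And>f h. f \<in> BL \<Longrightarrow> h \<in> BL \<Longrightarrow>
      (\<lambda>n. average (F n) id f - average (F n) id h) \<longlonglongrightarrow> 0 \<Longrightarrow> m f = m h"
    using cluster_mean [of "\<lambda>n. average (F n) id", OF avg] by blast
  have inv_chain: "m (\<lambda>x. f (x \<otimes> g)) = m f" if "g \<in> (\<Union>n. K n)" and f: "f \<in> BL" for f g
  proof (rule eq)
    obtain n0 where n0: "g \<in> K n0"
      using \<open>g \<in> (\<Union>n. K n)\<close> by blast
    then have gK: "g \<in> K n" if "n \<ge> n0" for n
      using lift_Suc_mono_le [of K, OF K(3) that] by blast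
    then have g: "g \<in> carrier G"
      using KG by blast
    show "(\<lambda>x. f (x \<otimes> g)) \<in> BL"
      using f g by (rule bounded_luc_right_translate)
    show "(\<lambda>n. average (F n) id (\<lambda>x. f (x \<otimes> g)) - average (F n) id f) \<longlonglongrightarrow> 0"
    proof (rule LIMSEQ_I)
      fix r :: real assume "0 < r"
      then have "0 < r / 2"
        by simp
      have "left_uniformly_continuous G T dist f"
        using f by (simp add: bounded_luc_def)
      then obtain U where U: "openin T U" "\<one> \<in> U"
        "\<And>x y. x \<in> carrier G \<Longrightarrow> y \<in> carrier G \<Longrightarrow> inv x \<otimes> y \<in> U \<Longrightarrow> dist (f x) (f y) < r / 2"
        using \<open>0 < r / 2\<close> by (rule left_uniformly_continuousE) blast
      obtain e where e: "0 < e" "X.mball \<one> e \<subseteq> U"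
        using U(1,2) unfolding T X.openin_mtopology by blast
      obtain n1 where n1: "inverse (real (Suc n1)) < e"
        using reals_Archimedean e(1) by blast
      have WU: "W n \<subseteq> U" if "n \<ge> n1" for n
      proof -
        have "inverse (real (Suc n)) \<le> inverse (real (Suc n1))"
          using that by (simp add: le_imp_inverse_le)
        then have "inverse (real (Suc n)) \<le> e"
          using n1 by (metis le_less_trans less_imp_le)
        then show ?thesis
          unfolding W_def using e(2) X.mball_subset_concentric by blast
      qed
      show "\<exists>no. \<forall>n\<ge>no. norm (average (F n) id (\<lambda>x. f (x \<otimes> g)) - average (F n) id f - 0) < r"
      proof (intro exI allI impI)
        fix n assume n: "n \<ge> max n0 n1"
        then obtain \<beta> where \<beta>: "bij_betw \<beta> (F n) (F n)" "\<And>x. x \<in> F n \<Longrightarrow> inv (x \<otimes> g) \<otimes> \<beta> x \<in> U"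
          using F(4) [OF gK [of n]] WU [of n] by auto
        have "\<bar>average (F n) id (\<lambda>x. f (x \<otimes> g)) - average (F n) id f\<bar> \<le> r / 2"
          using F(2,1) FG g \<beta> U(3) by (rule average_almost_invariant)
        then show "norm (average (F n) id (\<lambda>x. f (x \<otimes> g)) - average (F n) id f - 0) < r"
          using \<open>0 < r\<close> by simp
      qed
    qed
  qed (rule f)
  have "(\<Union>n. K n) \<subseteq> carrier G"
    using KG by blast
  then have "m (\<lambda>x. f (x \<otimes> g)) = m f" if "g \<in> carrier G" "f \<in> BL" for f g
    using dense inv_chain that by (rule mean.invariant_if_dense [OF m])
  then show ?thesis
    using m by blast
qed

lemma mean_if_invariant_mean:
  assumes "topological_group H S" "invariant_mean H S m"
  shows "mean H S m"
proof -
  interpret H: top_group H S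
    using assms(1) by (simp add: top_group_def top_group_axioms_def topological_group_def)
  show ?thesis
    using assms(2) unfolding invariant_mean_def bounded_left_uniform_eq
    by (intro mean.intro H.top_group_axioms mean_axioms.intro) blast+
qed

lemma (in top_group) ex_invariant_mean_dense_image:
  assumes "dense_image_of_amenable H S G T"
  shows "\<exists>m. mean G T m \<and> (\<forall>g\<in>carrier G. \<forall>f\<in>BL. m (\<lambda>x. f (x \<otimes> g)) = m f)"
proof -
  obtain \<phi> \<mu> where H: "topological_group H S" and \<phi>: "\<phi> \<in> hom H G" "continuous_map S T \<phi>"
    and dense: "Abstract_Topology.closure_of T (\<phi> ` carrier H) = carrier G"
    and \<mu>: "invariant_mean H S \<mu>"
    using assms unfolding dense_image_of_amenable_def amenable_def by blast
  interpret H: mean H S \<mu>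
    using H \<mu> by (rule mean_if_invariant_mean)
  interpret \<phi>: group_hom H G \<phi>
    using \<phi>(1) by unfold_locales (simp add: hom_def)
  have pull: "(\<lambda>x. f (\<phi> x)) \<in> bounded_luc H S" if f: "f \<in> BL" for f :: "'g \<Rightarrow> real"
  proof -
    have "bounded ((\<lambda>x. f (\<phi> x)) ` carrier H)"
      by (rule bounded_subset [of "f ` carrier G"]) (use f in \<open>auto simp: bounded_luc_def\<close>)
    moreover have "left_uniformly_continuous H S dist (\<lambda>x. f (\<phi> x))"
      unfolding left_uniformly_continuous_def
    proof (intro allI impI)
      fix e :: real assume "0 < e"
      have "left_uniformly_continuous G T dist f"
        using f by (simp add: bounded_luc_def)
      then obtain U where U: "openin T U" "\<one> \<in> U"
        "\<And>x y. x \<in> carrier G \<Longrightarrow> y \<in> carrier G \<Longrightarrow> inv x \<otimes> y \<in> U \<Longrightarrow> dist (f x) (f y) < e"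
        using \<open>0 < e\<close> by (rule left_uniformly_continuousE) blast
      show "\<exists>U. openin S U \<and> \<one>\<^bsub>H\<^esub> \<in> U \<and> (\<forall>x\<in>carrier H. \<forall>y\<in>carrier H.
          inv\<^bsub>H\<^esub> x \<otimes>\<^bsub>H\<^esub> y \<in> U \<longrightarrow> dist (f (\<phi> x)) (f (\<phi> y)) < e)"
      proof (intro exI conjI ballI impI)
        show "openin S {x \<in> topspace S. \<phi> x \<in> U}"
          using \<phi>(2) U(1) by (rule openin_continuous_map_preimage)
        show "\<one>\<^bsub>H\<^esub> \<in> {x \<in> topspace S. \<phi> x \<in> U}"
          using U(2) by simp
        fix x y assume "x \<in> carrier H" "y \<in> carrier H" "inv\<^bsub>H\<^esub> x \<otimes>\<^bsub>H\<^esub> y \<in> {x \<in> topspace S. \<phi> x \<in> U}"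
        then show "dist (f (\<phi> x)) (f (\<phi> y)) < e"
          using U(3) [of "\<phi> x" "\<phi> y"] by simp
      qed
    qed
    ultimately show ?thesis
      by (simp add: bounded_luc_def)
  qed
  define m where "m f = \<mu> (\<lambda>x. f (\<phi> x))" for f :: "'g \<Rightarrow> real"
  have m: "mean G T m"
  proof (intro mean.intro top_group_axioms mean_axioms.intro)
    show "m (\<lambda>x. 1) = 1"
      by (simp add: m_def H.m_one)
  qed (use pull in \<open>auto simp: m_def H.m_add H.m_mult intro!: H.m_nonneg\<close>)
  have inv_image: "m (\<lambda>x. f (x \<otimes> g)) = m f" if "g \<in> \<phi> ` carrier H" and f: "f \<in> BL" for f g
  proof -
    obtain h where h: "h \<in> carrier H" "g = \<phi> h"
      using \<open>g \<in> \<phi> ` carrier H\<close> by blast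
    have right_inv: "\<mu> (\<lambda>x. k (x \<otimes>\<^bsub>H\<^esub> h)) = \<mu> k" if "k \<in> bounded_luc H S" for k
      using \<mu> h(1) that by (simp add: invariant_mean_def bounded_left_uniform_eq)
    \<comment> \<open>The homomorphism law holds on the carrier only, so the two integrands may
      differ elsewhere; hence \<open>H.m_cong\<close>.\<close>
    have "m (\<lambda>x. f (x \<otimes> g)) = \<mu> (\<lambda>x. f (\<phi> (x \<otimes>\<^bsub>H\<^esub> h)))"
      unfolding m_def
      using pull [OF f] pull [OF bounded_luc_right_translate [OF f, of g]] h
      by (intro H.m_cong H.bounded_luc_right_translate [of "\<lambda>x. f (\<phi> x)"]) auto
    also have "\<dots> = m f"
      using right_inv [OF pull [OF f]] by (simp add: m_def)
    finally show ?thesis .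
  qed
  have "\<phi> ` carrier H \<subseteq> carrier G"
    by auto
  then have "m (\<lambda>x. f (x \<otimes> g)) = m f" if "g \<in> carrier G" "f \<in> BL" for f g
    using dense inv_image that by (rule mean.invariant_if_dense [OF m])
  then show ?thesis
    using m by blast
qed

lemma (in top_group) ex_invariant_mean:
  assumes "completely_metrizable_space T" "folner_amenable TYPE('h) G T"
  shows "\<exists>m. mean G T m \<and> (\<forall>g\<in>carrier G. \<forall>f\<in>BL. m (\<lambda>x. f (x \<otimes> g)) = m f)"
  using assms ex_invariant_mean_compact_chain ex_invariant_mean_dense_image
  unfolding folner_amenable_def by metis

section \<open>Finite-dimensional subspaces\<close>

text \<open>Only closeness on the finite set \<open>A\<close> is required of \<open>P\<close>. Since \<open>A\<close> contains the basis \<open>C\<close>, it makes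
  \<open>P\<close> Lipschitz with a constant independent of \<open>P\<close>, and a fine enough net of the compact unit
  sphere of the \<open>\<ell>\<^sup>1\<close>-norm of the coordinates does the rest.\<close>

lemma (in seminormed) finite_dim_comparison:
  assumes C: "finite C" "C \<subseteq> Y"
    and indep: "\<forall>a. N (\<Sum>c\<in>C. a c *\<^sub>R c) = 0 \<longrightarrow> (\<forall>c\<in>C. a c = 0)"
    and \<delta>: "0 < \<delta>"
  obtains A \<eta> where "finite A" "A \<subseteq> span C" "0 < \<eta>"
    "\<forall>P. seminormed (span C) P \<longrightarrow> (\<forall>a\<in>A. \<bar>P a - N a\<bar> \<le> \<eta>) \<longrightarrow>
       (\<forall>y\<in>span C. \<bar>P y - N y\<bar> \<le> \<delta> * N y)"
proof -
  define comb where "comb a = (\<Sum>c\<in>C. a c *\<^sub>R c)" for a :: "'y \<Rightarrow> real"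
  define l1 where "l1 a = (\<Sum>c\<in>C. \<bar>a c\<bar>)" for a :: "'y \<Rightarrow> real"
  \<comment> \<open>The extra 1 absorbs the tolerance \<open>\<eta> \<le> 1\<close>: every
    admissible \<open>P\<close> satisfies \<open>P c \<le> N c + 1 \<le> R\<close> on
    \<open>C\<close>.\<close>
  define R where "R = (\<Sum>c\<in>C. N c) + 1"
  \<comment> \<open>Coordinates range over the whole type, and those outside \<open>C\<close> are
    free in [-1,1]. They do not affect \<open>comb\<close> or \<open>l1\<close> and allow
    compactness to come from the product topology.\<close>
  define K where "K = {a \<in> PiE UNIV (\<lambda>_. {- 1..1::real}). l1 a = 1}"
  have spanY: "span C \<subseteq> Y"
    using C(2) subspace_Y by (rule span_minimal)
  have N_C: "N c + 1 \<le> R" if "c \<in> C" for c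
    unfolding R_def using that C nonneg by (intro add_mono member_le_sum) auto
  have R: "0 < R"
    unfolding R_def using C nonneg by (intro add_nonneg_pos sum_nonneg) auto
  have comb_span [simp]: "comb a \<in> span C" for a
    unfolding comb_def by (intro span_sum span_scale span_base)
  have comb_Y [simp]: "comb a \<in> Y" for a
    using spanY comb_span by blast
  have comb_diff: "comb a - comb b = comb (\<lambda>c. a c - b c)" for a b
    by (simp add: comb_def scaleR_diff_left sum_subtractf)
  have lipschitz: "P (comb a - comb b) \<le> R * l1 (\<lambda>c. a c - b c)"
    if P: "seminormed (span C) P" and PC: "\<And>c. c \<in> C \<Longrightarrow> P c \<le> R" for P a b
  proof -
    interpret P: seminormed "span C" P
      by (rule P)
    have "P (comb (\<lambda>c. a c - b c)) \<le> (\<Sum>c\<in>C. P ((a c - b c) *\<^sub>R c))"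
      unfolding comb_def using C(1) by (intro P.sum_le) (auto intro: span_scale span_base)
    also have "\<dots> = (\<Sum>c\<in>C. \<bar>a c - b c\<bar> * P c)"
      by (intro sum.cong refl P.scale span_base)
    also have "\<dots> \<le> (\<Sum>c\<in>C. \<bar>a c - b c\<bar> * R)"
      using PC by (intro sum_mono mult_left_mono) auto
    finally show ?thesis
      by (simp add: comb_diff l1_def sum_distrib_left mult.commute)
  qed
  have N: "seminormed (span C) N"
    using spanY by unfold_locales (auto simp: scale triangle subset_eq)
  have N_lip: "N (comb a - comb b) \<le> R * l1 (\<lambda>c. a c - b c)" for a b
    using N N_C by (intro lipschitz) force+
  have l1_cont: "continuous_on UNIV (\<lambda>a. l1 (\<lambda>c. a c - b c))" for b
    unfolding l1_def by (intro continuous_intros continuous_on_product_coordinates)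
  have "compact K"
  proof -
    have "compactin (product_topology (\<lambda>_. euclidean) UNIV) (PiE UNIV (\<lambda>_::'y. {- 1..1::real}))"
      unfolding compactin_PiE by simp
    then have "compact (PiE UNIV (\<lambda>_::'y. {- 1..1::real}))"
      by (simp add: euclidean_product_topology)
    moreover have "closed {a. l1 a = 1}"
      unfolding l1_def by (intro closed_Collect_eq continuous_intros continuous_on_product_coordinates)
    ultimately have "compact (PiE UNIV (\<lambda>_::'y. {- 1..1::real}) \<inter> {a. l1 a = 1})"
      by (rule compact_Int_closed)
    then show ?thesis
      by (simp add: K_def Int_def)
  qed
  \<comment> \<open>\<open>K\<close> is empty just when \<open>C\<close> is, and then any
    \<open>\<kappa>\<close> works. Otherwise the minimum of \<open>N\<close> on the sphere is
    positive, because \<open>l1 a = 1\<close> rules out that all coordinates vanish.\<close>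
  have "\<exists>\<kappa>>0. \<forall>a\<in>K. \<kappa> \<le> N (comb a)"
  proof (cases "K = {}")
    case False
    have "continuous_on K (\<lambda>a. N (comb a))"
      unfolding continuous_on_def
    proof
      fix b
      have "((\<lambda>a. R * l1 (\<lambda>c. a c - b c)) \<longlongrightarrow> R * l1 (\<lambda>c. b c - b c)) (at b within K)"
        using continuous_on_subset [OF l1_cont [of b], of "insert b K"] unfolding continuous_on_def
        by (intro tendsto_mult_left) (auto intro: tendsto_within_subset)
      then have "((\<lambda>a. R * l1 (\<lambda>c. a c - b c)) \<longlongrightarrow> 0) (at b within K)"
        by (simp add: l1_def)
      moreover have "\<forall>\<^sub>F a in at b within K. norm (N (comb a) - N (comb b)) \<le> R * l1 (\<lambda>c. a c - b c)"
      proof (intro always_eventually allI)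
        show "norm (N (comb a) - N (comb b)) \<le> R * l1 (\<lambda>c. a c - b c)" for a
          using reverse_triangle [of "comb a" "comb b"] N_lip [of a b] by simp
      qed
      ultimately have "((\<lambda>a. N (comb a) - N (comb b)) \<longlongrightarrow> 0) (at b within K)"
        by (rule Lim_null_comparison [rotated])
      then show "((\<lambda>a. N (comb a)) \<longlongrightarrow> N (comb b)) (at b within K)"
        by (simp add: LIM_zero_iff)
    qed
    then obtain a where a: "a \<in> K" "\<And>b. b \<in> K \<Longrightarrow> N (comb a) \<le> N (comb b)"
      using continuous_attains_inf [OF \<open>compact K\<close> False] by blast
    have "N (comb a) \<noteq> 0"
      using spec [OF indep, of a] a(1) by (auto simp: K_def l1_def comb_def)
    then show ?thesis
      using a nonneg [of "comb a"] by (intro exI [of _ "N (comb a)"]) auto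
  qed (use zero_less_one in blast)
  then obtain \<kappa> where \<kappa>: "0 < \<kappa>" "\<And>a. a \<in> K \<Longrightarrow> \<kappa> \<le> N (comb a)"
    by blast
  \<comment> \<open>Three errors of size at most \<open>\<kappa> * \<delta> / 3\<close> occur:
    moving from \<open>b\<close> to the net point \<open>a\<close> under \<open>P\<close>,
    exchanging \<open>P\<close> for \<open>N\<close> at \<open>a\<close>, and moving back under
    \<open>N\<close>.\<close>
  define \<rho> where "\<rho> = \<kappa> * \<delta> / (3 * R)"
  have \<rho>: "0 < \<rho>" "R * \<rho> = \<kappa> * \<delta> / 3"
    using \<kappa>(1) \<delta> R by (auto simp: \<rho>_def)
  define U where "U a = {b. l1 (\<lambda>c. b c - a c) < \<rho>}" for a
  have openU: "open (U a)" for a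
    unfolding U_def by (intro open_Collect_less l1_cont continuous_on_const)
  have "K \<subseteq> (\<Union>a\<in>K. U a)"
    using \<rho>(1) by (auto simp: l1_def U_def)
  then obtain A where A: "A \<subseteq> K" "finite A" "K \<subseteq> (\<Union>a\<in>A. U a)"
    by (rule compactE_image [OF \<open>compact K\<close> openU])
  define \<eta> where "\<eta> = min 1 (\<kappa> * \<delta> / 3)"
  show thesis
  proof (rule that [of "comb ` A \<union> C" \<eta>]; (intro allI impI ballI)?)
    show "finite (comb ` A \<union> C)" "comb ` A \<union> C \<subseteq> span C" "0 < \<eta>"
      using A C \<kappa> \<delta> by (auto simp: \<eta>_def span_base)
    fix P y
    assume P: "seminormed (span C) P" and "\<forall>a\<in>comb ` A \<union> C. \<bar>P a - N a\<bar> \<le> \<eta>"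
      and y: "y \<in> span C"
    then have close: "\<bar>P a - N a\<bar> \<le> \<eta>" if "a \<in> comb ` A \<union> C" for a
      using that by blast
    interpret P: seminormed "span C" P
      by (rule P)
    have P_lip: "P (comb a - comb b) \<le> R * l1 (\<lambda>c. a c - b c)" for a b
    proof (rule lipschitz [OF P])
      fix c assume c: "c \<in> C"
      then show "P c \<le> R"
        using close [of c] N_C [OF c] unfolding \<eta>_def by (simp add: abs_le_iff)
    qed
    have sphere: "\<bar>P (comb b) - N (comb b)\<bar> \<le> \<delta> * N (comb b)" if b: "b \<in> K" for b
    proof -
      obtain a where a: "a \<in> A" "l1 (\<lambda>c. b c - a c) < \<rho>"
        using A(3) b by (auto simp: U_def)
      have "R * l1 (\<lambda>c. b c - a c) \<le> \<kappa> * \<delta> / 3"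
        using a(2) R unfolding \<rho>(2) [symmetric] by (intro mult_left_mono) auto
      moreover have "\<bar>P (comb a) - N (comb a)\<bar> \<le> \<kappa> * \<delta> / 3"
        using close [of "comb a"] a(1) by (simp add: \<eta>_def)
      moreover have "\<kappa> * \<delta> \<le> \<delta> * N (comb b)"
        using \<kappa>(2) [OF b] \<delta> by (simp add: mult.commute mult_left_mono)
      ultimately show ?thesis
        using P.reverse_triangle [OF comb_span [of b] comb_span [of a]] P_lip [of b a] N_lip [of b a]
          reverse_triangle [OF comb_Y [of b] comb_Y [of a]] by linarith
    qed
    obtain a where a: "y = (\<Sum>c\<in>C. a c *\<^sub>R c)"
      using y span_finite [OF C(1)] by auto
    define L where "L = l1 a"
    show "\<bar>P y - N y\<bar> \<le> \<delta> * N y"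
    proof (cases "L = 0")
      case True
      then have "y = 0"
        using C(1) by (auto simp: a L_def l1_def sum_nonneg_eq_0_iff)
      then show ?thesis
        by simp
    next
      case False
      then have L: "0 < L"
        using sum_nonneg [of C "\<lambda>c. \<bar>a c\<bar>"] by (simp add: L_def l1_def order_less_le)
      \<comment> \<open>Normalisation to the sphere; the value 0 off \<open>C\<close> keeps every
        coordinate in [-1,1], as \<open>K\<close> requires.\<close>
      define b where "b c = (if c \<in> C then a c / L else 0)" for c
      have "\<bar>a c\<bar> \<le> L" if "c \<in> C" for c
        unfolding L_def l1_def using that C(1) by (intro member_le_sum) auto
      then have "\<bar>b c\<bar> \<le> 1" for c
        using L by (simp add: b_def)
      moreover have "l1 b = (\<Sum>c\<in>C. \<bar>a c\<bar> / L)"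
        using L by (simp add: b_def l1_def)
      then have "l1 b = 1"
        using L by (simp add: L_def l1_def flip: sum_divide_distrib)
      ultimately have "b \<in> K"
        by (auto simp: K_def abs_le_iff minus_le_iff)
      moreover have "y = L *\<^sub>R comb b"
        using L by (simp add: a comb_def b_def scaleR_sum_right)
      then have "P y = L * P (comb b)" "N y = L * N (comb b)"
        using L by (simp_all add: P.scale scale)
      moreover from this have "P y - N y = L * (P (comb b) - N (comb b))"
        by (simp add: right_diff_distrib)
      ultimately show ?thesis
        using sphere [of b] L by (simp add: abs_mult mult.left_commute)
    qed
  qed
qed

text \<open>Finitely many generators are lifted to representatives, and a lift of least cardinality
  is taken. Its independence is modulo null vectors, which makes \<open>N\<close> a norm on
  \<open>span C\<close> and not merely a seminorm.\<close>

lemma (in seminormed) finite_dim_subspace_span: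
  assumes F: "finite_dim_subspace F Q"
  obtains C where "finite C" "C \<subseteq> Y" "F = cls ` span C"
    "\<forall>a. N (\<Sum>c\<in>C. a c *\<^sub>R c) = 0 \<longrightarrow> (\<forall>c\<in>C. a c = 0)"
proof -
  interpret M: module real_ring Q
    by (rule module_Q)
  have F_sub: "submodule F real_ring Q"
    using F by (simp add: finite_dim_subspace_def)
  have "\<exists>B. finite B \<and> B \<subseteq> F \<and> (\<forall>W. submodule W real_ring Q \<and> B \<subseteq> W \<longrightarrow> F \<subseteq> W)"
    using F by (simp add: finite_dim_subspace_def)
  then obtain B where B: "finite B" "B \<subseteq> F"
    and gen: "\<And>W. submodule W real_ring Q \<Longrightarrow> B \<subseteq> W \<Longrightarrow> F \<subseteq> W"
    by metis
  have spanY: "span C \<subseteq> Y" if "C \<subseteq> Y" for C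
    using that subspace_Y by (rule span_minimal)
  have F_Q: "F \<subseteq> carrier Q"
    using M.submoduleE(1) [OF F_sub] .
  define spanning where "spanning C \<longleftrightarrow> finite C \<and> C \<subseteq> Y \<and> F = cls ` span C" for C
  have "\<exists>C. spanning C"
  proof -
    have "B \<subseteq> cls ` Y"
      using B(2) F_Q by (simp add: carrier_Q)
    then obtain C where C: "C \<subseteq> Y" "finite C" "B = cls ` C"
      using finite_subset_image [OF B(1)] by metis
    have "submodule (cls ` span C) real_ring Q"
    proof (rule M.submoduleI)
      show "cls ` span C \<subseteq> carrier Q"
        using spanY [OF C(1)] by (auto simp: carrier_Q)
      show "\<zero>\<^bsub>Q\<^esub> \<in> cls ` span C"
        by (simp add: zero_Q span_zero)
      fix v assume "v \<in> cls ` span C"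
      then obtain x where x: "x \<in> span C" "x \<in> Y" "v = cls x"
        using spanY [OF C(1)] by blast
      have "\<ominus>\<^bsub>Q\<^esub> v = cls (- x)"
        using minus_Q [of 0 x] x M.M.l_zero M.M.a_inv_closed
        by (simp add: zero_Q [symmetric] a_minus_def)
      then show "\<ominus>\<^bsub>Q\<^esub> v \<in> cls ` span C"
        using x(1) by (simp add: span_neg)
      show "a \<odot>\<^bsub>Q\<^esub> v \<in> cls ` span C" for a
        using x by (simp add: smult_Q span_scale)
      fix w assume "w \<in> cls ` span C"
      then obtain y where "y \<in> span C" "y \<in> Y" "w = cls y"
        using spanY [OF C(1)] by blast
      then show "v \<oplus>\<^bsub>Q\<^esub> w \<in> cls ` span C"
        using x by (simp add: add_Q span_add)
    qed
    moreover have "B \<subseteq> cls ` span C"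
      using C(3) span_superset by blast
    ultimately have "F \<subseteq> cls ` span C"
      by (rule gen)
    moreover have "span C \<subseteq> {y \<in> Y. cls y \<in> F}"
    proof (rule span_minimal)
      show "C \<subseteq> {y \<in> Y. cls y \<in> F}"
        using C B(2) by blast
      show "subspace {y \<in> Y. cls y \<in> F}"
        unfolding subspace_def
      proof (intro conjI ballI allI)
        interpret F: submodule F real_ring Q
          by (rule F_sub)
        show "0 \<in> {y \<in> Y. cls y \<in> F}"
          using F.one_closed by (simp add: zero_Q)
        fix x assume x: "x \<in> {y \<in> Y. cls y \<in> F}"
        then show "c *\<^sub>R x \<in> {y \<in> Y. cls y \<in> F}" for c
          using F.smult_closed [of c "cls x"] by (simp add: smult_Q real_ring_def)
        fix y assume "y \<in> {y \<in> Y. cls y \<in> F}"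
        then show "x + y \<in> {y \<in> Y. cls y \<in> F}"
          using x M.submoduleE(5) [OF F_sub, of "cls x" "cls y"] by (simp add: add_Q)
      qed
    qed
    ultimately have "F = cls ` span C"
      by blast
    then show ?thesis
      using C by (auto simp: spanning_def)
  qed
  then obtain C where C: "spanning C" and least: "\<And>D. spanning D \<Longrightarrow> card C \<le> card D"
    using ex_has_least_nat [of spanning _ card] by blast
  have finC: "finite C" and CY: "C \<subseteq> Y" and F_eq: "F = cls ` span C"
    using C by (auto simp: spanning_def)
  show thesis
  proof (rule that [OF finC CY F_eq], intro allI impI ballI, rule ccontr)
    fix a d assume null: "N (\<Sum>c\<in>C. a c *\<^sub>R c) = 0" and d: "d \<in> C" "a d \<noteq> 0"
    have zY: "(\<Sum>c\<in>C. a c *\<^sub>R c) \<in> Y"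
      using CY by (intro subspace_sum [OF subspace_Y]) auto
    have "cls ` span C \<subseteq> cls ` span (C - {d})"
    proof
      fix v assume "v \<in> cls ` span C"
      then obtain b where v: "v = cls (\<Sum>c\<in>C. b c *\<^sub>R c)"
        using span_finite [OF finC] by auto
      \<comment> \<open>Subtracting \<open>t\<close> times the null combination removes the
        coefficient of \<open>d\<close> without changing the class, so \<open>d\<close> could be
        dropped from a minimal \<open>C\<close>.\<close>
      define t where "t = b d / a d"
      define y where "y = (\<Sum>c\<in>C - {d}. (b c - t * a c) *\<^sub>R c)"
      have "(\<Sum>c\<in>C. b c *\<^sub>R c) - t *\<^sub>R (\<Sum>c\<in>C. a c *\<^sub>R c) = (\<Sum>c\<in>C. (b c - t * a c) *\<^sub>R c)"
        by (simp add: scaleR_sum_right scaleR_diff_left sum_subtractf)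
      also have "\<dots> = y"
        unfolding y_def using d by (subst sum.remove [OF finC d(1)]) (simp add: t_def)
      finally have diff: "(\<Sum>c\<in>C. b c *\<^sub>R c) - y = t *\<^sub>R (\<Sum>c\<in>C. a c *\<^sub>R c)"
        by (simp add: algebra_simps)
      have "y \<in> span (C - {d})"
        unfolding y_def by (intro span_sum span_scale span_base)
      moreover have "N ((\<Sum>c\<in>C. b c *\<^sub>R c) - y) = 0"
        unfolding diff using zY null by (simp add: scale)
      then have "v = cls y"
        unfolding v using CY calculation spanY [of "C - {d}"]
        by (subst cls_eq_iff) (auto intro!: subspace_sum [OF subspace_Y])
      ultimately show "v \<in> cls ` span (C - {d})"
        by blast
    qed
    moreover have "cls ` span (C - {d}) \<subseteq> cls ` span C"
      by (intro image_mono span_mono) blast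
    ultimately have "spanning (C - {d})"
      using finC CY F_eq by (auto simp: spanning_def)
    then show False
      using least finC d(1) card_Diff1_less by (metis not_less)
  qed
qed

text \<open>The vector \<open>z\<close> keeps both suprema over nonempty sets; a supremum over the
  empty set would be an unspecified number.\<close>

lemma operator_norm_inverse_product_le:
  assumes AB: "0 < A" "0 \<le> B"
    and lower: "\<And>v. v \<in> F \<Longrightarrow> A * vnorm V v \<le> vnorm W (f v)"
    and upper: "\<And>v. v \<in> F \<Longrightarrow> vnorm W (f v) \<le> B * vnorm V v"
    and inj: "inj_on f F" and z: "z \<in> F" "vnorm V z = 0"
  shows "operator_norm F V W f * operator_norm (f ` F) W V (inv_into F f) \<le> B * (1 / A)"
proof (rule mult_mono)
  show "operator_norm F V W f \<le> B"
    unfolding operator_norm_def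
  proof (rule cSUP_least)
    fix v assume v: "v \<in> {v \<in> F. vnorm V v \<le> 1}"
    then have "B * vnorm V v \<le> B"
      using AB(2) mult_left_mono [of "vnorm V v" 1 B] by simp
    then show "vnorm W (f v) \<le> B"
      using upper [of v] v by simp
  qed (use z in auto)
  have fz: "vnorm W (f z) \<le> 1"
    using upper [OF z(1)] z(2) by simp
  have bound: "vnorm V (inv_into F f w) \<le> 1 / A" if w: "w \<in> {w \<in> f ` F. vnorm W w \<le> 1}" for w
  proof -
    obtain v where v: "v \<in> F" "w = f v"
      using w by blast
    then have "A * vnorm V v \<le> 1"
      using lower [OF v(1)] w by simp
    then show ?thesis
      using v inj AB(1) by (simp add: field_simps)
  qed
  show "operator_norm (f ` F) W V (inv_into F f) \<le> 1 / A"
    unfolding operator_norm_def by (rule cSUP_least [OF _ bound]) (use z fz in auto)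
  \<comment> \<open>Multiplying the two bounds needs the second operator norm to be nonnegative; its
    value at \<open>f z\<close> shows this once the set is known to be bounded above.\<close>
  have "vnorm V (inv_into F f (f z)) \<le> operator_norm (f ` F) W V (inv_into F f)"
    unfolding operator_norm_def
    by (rule cSUP_upper) (use z fz bound in \<open>auto intro!: bdd_aboveI2 [of _ _ "1 / A"]\<close>)
  then show "0 \<le> operator_norm (f ` F) W V (inv_into F f)"
    using z inj by simp
qed (rule AB(2))

section \<open>Step functions in the Lebesgue-Bochner spaces\<close>

text \<open>Measurability of \<open>g\<close> comes for free from completeness of Lebesgue measure.
  This matters because \<open>Lp\<close> computes with chosen representatives, known only almost
  everywhere.\<close>

lemma integral_lebesgue_on_cong_AE:
  fixes f g :: "'a::euclidean_space \<Rightarrow> real"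
  assumes S: "S \<in> sets lebesgue" and f: "f \<in> borel_measurable (lebesgue_on S)"
    and eq: "AE x in lebesgue_on S. f x = g x"
  shows "integral\<^sup>L (lebesgue_on S) f = integral\<^sup>L (lebesgue_on S) g"
proof -
  have f': "(\<lambda>x. indicator S x *\<^sub>R f x) \<in> borel_measurable lebesgue"
    using f S borel_measurable_restrict_space_iff [of S lebesgue f] by (simp add: mult.commute)
  have eq': "AE x in lebesgue. indicator S x *\<^sub>R f x = indicator S x *\<^sub>R g x"
    using eq S by (auto simp: AE_restrict_space_iff indicator_def elim!: eventually_mono)
  have "integral\<^sup>L lebesgue (\<lambda>x. indicator S x *\<^sub>R f x) = integral\<^sup>L lebesgue (\<lambda>x. indicator S x *\<^sub>R g x)"
    using f' borel_measurable_AE [OF f' eq'] eq' by (rule integral_cong_AE)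
  then show ?thesis
    using S by (simp add: integral_restrict_space)
qed

lemma ae_class_eq_iff: "ae_class f = ae_class g \<longleftrightarrow> (AE x in unit_lebesgue. f x = g x)"
proof
  assume "ae_class f = ae_class g"
  then have "f \<in> ae_class g"
    by (auto simp: ae_class_def)
  then show "AE x in unit_lebesgue. f x = g x"
    by (simp add: ae_class_def)
next
  assume eq: "AE x in unit_lebesgue. f x = g x"
  have "(AE x in unit_lebesgue. h x = f x) \<longleftrightarrow> (AE x in unit_lebesgue. h x = g x)" for h
  proof
    assume "AE x in unit_lebesgue. h x = f x"
    with eq show "AE x in unit_lebesgue. h x = g x"
      by eventually_elim simp
  next
    assume "AE x in unit_lebesgue. h x = g x"
    with eq show "AE x in unit_lebesgue. h x = f x"
      by eventually_elim simp
  qed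
  then show "ae_class f = ae_class g"
    by (simp add: ae_class_def)
qed

lemma ae_class_rep: "AE x in unit_lebesgue. (SOME g. g \<in> ae_class f) x = f x"
proof -
  have "f \<in> ae_class f"
    by (simp add: ae_class_def)
  then have "(SOME g. g \<in> ae_class f) \<in> ae_class f"
    by (rule someI [of "\<lambda>g. g \<in> ae_class f"])
  then show ?thesis
    by (simp add: ae_class_def)
qed

lemma Lp_add: "ae_class f \<oplus>\<^bsub>Lp p\<^esub> ae_class g = ae_class (\<lambda>x. f x + g x)"
  unfolding Lp_def using ae_class_rep [of f] ae_class_rep [of g]
  by (auto simp: ae_class_eq_iff elim!: eventually_elim2)

lemma Lp_smult: "c \<odot>\<^bsub>Lp p\<^esub> ae_class f = ae_class (\<lambda>x. c *\<^sub>R f x)"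
  unfolding Lp_def using ae_class_rep [of f] by (auto simp: ae_class_eq_iff elim!: eventually_mono)

lemma Lp_vnorm:
  assumes "(\<lambda>x. norm (f x) powr p) \<in> borel_measurable unit_lebesgue"
  shows "vnorm (Lp p) (ae_class f) = (LINT x|unit_lebesgue. norm (f x) powr p) powr (1 / p)"
proof -
  have "AE x in unit_lebesgue. norm (f x) powr p = norm ((SOME g. g \<in> ae_class f) x) powr p"
    using ae_class_rep [of f] by eventually_elim simp
  then show ?thesis
    using integral_lebesgue_on_cong_AE [OF _ assms] by (simp add: Lp_def)
qed

text \<open>At the right end point \<open>\<lfloor>n x\<rfloor> = n\<close>, where \<open>v\<close> must not be evaluated.\<close>

definition step_fun :: "nat \<Rightarrow> (nat \<Rightarrow> 'e::real_vector) \<Rightarrow> real \<Rightarrow> 'e" where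
  "step_fun n v x = (if \<lfloor>n * x\<rfloor> < int n then v (nat \<lfloor>n * x\<rfloor>) else 0)"

lemma step_fun_add: "step_fun n (\<lambda>j. v j + w j) = (\<lambda>x. step_fun n v x + step_fun n w x)"
  and step_fun_scale: "step_fun n (\<lambda>j. c *\<^sub>R v j) = (\<lambda>x. c *\<^sub>R step_fun n v x)"
  by (auto simp: step_fun_def fun_eq_iff)

lemma simple_function_step_fun: "simple_function unit_lebesgue (step_fun n v)"
proof -
  have "(\<lambda>x. n * x) \<in> borel_measurable unit_lebesgue"
    by (intro continuous_imp_measurable_on_sets_lebesgue continuous_intros) auto
  \<comment> \<open>A step function factors through the integers, where all sets are measurable, so
    no measurable structure on the target is involved.\<close>
  then have "(\<lambda>x. \<lfloor>n * x\<rfloor>) \<in> measurable unit_lebesgue (count_space UNIV)"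
    by measurable
  then have "step_fun n v \<in> measurable unit_lebesgue (count_space UNIV)"
    unfolding step_fun_def by (rule measurable_compose) simp
  then have "step_fun n v -` {y} \<inter> space unit_lebesgue \<in> sets unit_lebesgue" for y
    by (rule measurable_sets) simp
  moreover have "step_fun n v x \<in> insert 0 (v ` {..<n})" if "x \<in> space unit_lebesgue" for x
    using that by (auto simp: step_fun_def nat_less_iff intro!: imageI)
  then have "step_fun n v ` space unit_lebesgue \<subseteq> insert 0 (v ` {..<n})"
    by (rule image_subsetI)
  then have "finite (step_fun n v ` space unit_lebesgue)"
    by (rule finite_subset) simp
  ultimately show ?thesis
    by (simp add: simple_function_def)
qed

text \<open>At most one interval contains \<open>x\<close>, the one indexed by the floor of n x. For
  x \<ge> 1 none of them does, and both sides are 0 since \<open>0 powr p = 0\<close>.\<close>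

lemma norm_powr_step_fun:
  fixes v :: "nat \<Rightarrow> 'e::real_normed_vector"
  assumes n: "0 < n" and x: "0 \<le> x"
  shows "norm (step_fun n v x) powr p =
    (\<Sum>j<n. norm (v j) powr p * indicator {j / n..<(j + 1) / n} x)"
proof -
  define k where "k = nat \<lfloor>n * x\<rfloor>"
  have k: "\<lfloor>n * x\<rfloor> = int k"
    using x by (simp add: k_def)
  have "x \<in> {j / n..<(j + 1) / n} \<longleftrightarrow> j = k" for j :: nat
  proof -
    have "x \<in> {j / n..<(j + 1) / n} \<longleftrightarrow> \<lfloor>n * x\<rfloor> = int j"
      using n by (simp add: floor_eq_iff field_simps)
    then show ?thesis
      using k by auto
  qed
  then have "(\<Sum>j<n. norm (v j) powr p * indicator {j / n..<(j + 1) / n} x) =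
      (\<Sum>j<n. if j = k then norm (v j) powr p else 0)"
    by (intro sum.cong) (auto simp: indicator_def)
  then show ?thesis
    by (simp add: step_fun_def k)
qed

lemma integral_step_fun:
  fixes v :: "nat \<Rightarrow> 'e::real_normed_vector"
  assumes n: "0 < n"
  shows "integrable unit_lebesgue (\<lambda>x. norm (step_fun n v x) powr p)" (is ?int)
    and "(LINT x|unit_lebesgue. norm (step_fun n v x) powr p) = (\<Sum>j<n. norm (v j) powr p) / n" (is ?eq)
proof -
  define I where "I j = {real j / n..<(j + 1) / n}" for j
  interpret finite_measure unit_lebesgue
    by (intro finite_measure_lebesgue_on) simp
  have I01: "I j \<subseteq> {0..1}" if "j < n" for j
  proof
    fix x assume "x \<in> I j"
    then have "real j / n \<le> x" "x < (real j + 1) / n"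
      by (simp_all add: I_def)
    moreover have "(real j + 1) / n \<le> 1" "0 \<le> real j / n"
      using that by (simp_all add: field_simps)
    ultimately show "x \<in> {0..1}"
      unfolding atLeastAtMost_iff by linarith
  qed
  have sets: "I j \<in> sets unit_lebesgue" if "j < n" for j
    using I01 [OF that] by (auto simp: sets_restrict_space_iff I_def)
  have "measure unit_lebesgue (I j) = 1 / n" if "j < n" for j
  proof -
    have "measure unit_lebesgue (I j) = measure lebesgue (I j)"
      using I01 [OF that] by (intro measure_restrict_space) auto
    also have "\<dots> = measure lborel (I j)"
      by (simp add: I_def)
    also have "\<dots> = 1 / n"
      using n by (simp add: I_def divide_right_mono add_divide_distrib)
    finally show ?thesis .
  qed
  note meas = this
  have *: "has_bochner_integral unit_lebesgue (\<lambda>x. \<Sum>j<n. norm (v j) powr p * indicator (I j) x)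
      (\<Sum>j<n. norm (v j) powr p * (1 / n))"
  proof (intro has_bochner_integral_sum has_bochner_integral_mult_right)
    fix j assume "j \<in> {..<n}"
    then show "has_bochner_integral unit_lebesgue (indicator (I j)) (1 / n)"
      using has_bochner_integral_real_indicator [OF sets, of j] meas [of j] by (simp add: less_top [symmetric])
  qed
  have eq: "norm (step_fun n v x) powr p = (\<Sum>j<n. norm (v j) powr p * indicator (I j) x)"
    if "x \<in> space unit_lebesgue" for x
    using norm_powr_step_fun [OF n, of x v p] that by (simp add: I_def add.commute)
  have "has_bochner_integral unit_lebesgue (\<lambda>x. norm (step_fun n v x) powr p)
      (\<Sum>j<n. norm (v j) powr p * (1 / n))"
    by (rule has_bochner_integral_cong [THEN iffD2, OF refl eq refl *])
  then show ?int ?eq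
    by (auto simp: has_bochner_integral_iff sum_divide_distrib)
qed

lemma step_fun_in_Lp: "0 < n \<Longrightarrow> ae_class (step_fun n v) \<in> carrier (Lp p)"
  by (auto simp: Lp_def Lp_functions_def strongly_measurable_def integral_step_fun
      intro!: imageI exI [of _ "\<lambda>_. step_fun n v"] simple_function_step_fun)

text \<open>For \<open>v j = f (x j)\<close> the right-hand side is
  \<open>mean_norm (average {..<n} x) p f\<close>: the equal lengths 1/n are the weights of the
  average.\<close>

lemma vnorm_step_fun:
  "0 < n \<Longrightarrow> vnorm (Lp p) (ae_class (step_fun n v)) = ((\<Sum>j<n. norm (v j) powr p) / n) powr (1 / p)"
  using Lp_vnorm [OF borel_measurable_integrable [OF integral_step_fun(1)]]
  by (simp add: integral_step_fun(2))

section \<open>Finite representability\<close>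

context mean
begin

lemma average_mean_norm_tendsto:
  fixes f :: "'a \<Rightarrow> 'g \<Rightarrow> 'e::real_normed_vector"
  assumes "finite A" and f: "\<And>a. a \<in> A \<Longrightarrow> f a \<in> BL" and p: "0 < p"
  obtains x where "range x \<subseteq> carrier G"
    "\<And>a. a \<in> A \<Longrightarrow> (\<lambda>n. mean_norm (average {..<n} x) p (f a)) \<longlonglongrightarrow> mean_norm m p (f a)"
proof -
  obtain x where x: "range x \<subseteq> carrier G"
    "\<And>a. a \<in> A \<Longrightarrow> (\<lambda>n. average {..<n} x (\<lambda>x. norm (f a x) powr p)) \<longlonglongrightarrow> m (\<lambda>x. norm (f a x) powr p)"
    using averages_tendsto_mean [OF \<open>finite A\<close>, of "\<lambda>a x. norm (f a x) powr p"]
      norm_powr_bounded_luc [OF f p] by blast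
  show thesis
  proof (rule that [OF x(1)])
    fix a assume "a \<in> A"
    then show "(\<lambda>n. mean_norm (average {..<n} x) p (f a)) \<longlonglongrightarrow> mean_norm m p (f a)"
      unfolding mean_norm_def using p
      by (intro tendsto_powr' [OF x(2) tendsto_const]) (auto simp: average_def intro!: always_eventually divide_nonneg_nonneg sum_nonneg)
  qed
qed

text \<open>On a finite-dimensional subspace of the completion, the norm is approximated by evaluating
  the Cauchy sequences at a large index and replacing the mean by the average over finitely many
  points. The resulting norm is that of a space of step functions.\<close>

lemma finitely_representable_completion:
  assumes p: "1 \<le> p"
  shows "finitely_representable (completion (BL :: ('g \<Rightarrow> 'e::banach) set) (mean_norm m p))
    (Lp p :: (real \<Rightarrow> 'e) set normed_module)"
  unfolding finitely_representable_def
proof (intro allI impI, elim conjE)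
  let ?B = "BL :: ('g \<Rightarrow> 'e) set"
  let ?N = "mean_norm m p :: ('g \<Rightarrow> 'e) \<Rightarrow> real"
  let ?L = "Lp p :: (real \<Rightarrow> 'e) set normed_module"
  interpret X: seminormed ?B ?N
    using p by (rule seminormed_mean_norm)
  interpret C: seminormed "cauchy_seqs ?B ?N" "lim_norm ?N"
    by (rule X.seminormed_completion)
  let ?Y = "cauchy_seqs ?B ?N"
  fix F and \<epsilon> :: real
  assume F: "finite_dim_subspace F C.Q" and \<epsilon>: "0 < \<epsilon>"
  obtain D where D: "finite D" "D \<subseteq> ?Y" "F = C.cls ` span D"
    and indep: "\<forall>a. lim_norm ?N (\<Sum>c\<in>D. a c *\<^sub>R c) = 0 \<longrightarrow> (\<forall>c\<in>D. a c = 0)"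
    by (rule C.finite_dim_subspace_span [OF F])
  have spanY: "y \<in> ?Y" if "y \<in> span D" for y
    using that span_minimal [OF D(2) C.subspace_Y] by blast
  have definite: "y = 0" if y: "y \<in> span D" "lim_norm ?N y = 0" for y
  proof -
    obtain a where a: "y = (\<Sum>c\<in>D. a c *\<^sub>R c)"
      using y(1) span_finite [OF D(1)] by auto
    then show ?thesis
      using spec [OF indep, of a] y(2) by simp
  qed
  \<comment> \<open>Chosen so that (1 + \<delta>) / (1 - \<delta>) = 1 + 2 \<epsilon> / 3.\<close>
  define \<delta> where "\<delta> = \<epsilon> / (3 + \<epsilon>)"
  have \<delta>: "0 < \<delta>" "\<delta> < 1"
    using \<epsilon> by (auto simp: \<delta>_def)
  have \<delta>_eqs: "1 - \<delta> = 3 / (3 + \<epsilon>)" "1 + \<delta> = (3 + 2 * \<epsilon>) / (3 + \<epsilon>)"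
    using \<epsilon> by (auto simp: \<delta>_def field_simps)
  have \<delta>\<epsilon>: "(1 + \<delta>) * (1 / (1 - \<delta>)) < 1 + \<epsilon>"
    unfolding \<delta>_eqs using \<epsilon> by (simp add: field_simps add_pos_pos)
  obtain A \<eta> where A: "finite A" "A \<subseteq> span D" and \<eta>: "0 < \<eta>"
    and compare: "\<forall>P. seminormed (span D) P \<longrightarrow> (\<forall>a\<in>A. \<bar>P a - lim_norm ?N a\<bar> \<le> \<eta>) \<longrightarrow>
      (\<forall>y\<in>span D. \<bar>P y - lim_norm ?N y\<bar> \<le> \<delta> * lim_norm ?N y)"
    by (rule C.finite_dim_comparison [OF D(1,2) indep \<delta>(1)])
  \<comment> \<open>The tolerance \<open>\<eta>\<close> is split: one half for replacing each
    sequence in \<open>A\<close> by its \<open>n\<close>-th term, one half for replacing the mean by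
    an average of \<open>k\<close> points.\<close>
  have "\<forall>\<^sub>F n in sequentially. \<forall>a\<in>A. dist (?N (a n)) (lim_norm ?N a) < \<eta> / 2"
    using A spanY \<eta> by (intro eventually_ball_finite ballI tendstoD [OF X.lim_norm]) auto
  then obtain n where n: "\<And>a. a \<in> A \<Longrightarrow> dist (?N (a n)) (lim_norm ?N a) < \<eta> / 2"
    using eventually_happens' [OF sequentially_bot] by blast
  have A_n: "a n \<in> ?B" if "a \<in> A" for a
    using X.cauchy_seqs_mem A(2) spanY that by blast
  obtain x where x: "range x \<subseteq> carrier G"
    and lim: "\<And>a. a \<in> A \<Longrightarrow> (\<lambda>k. mean_norm (average {..<k} x) p (a n)) \<longlonglongrightarrow> ?N (a n)"
    using average_mean_norm_tendsto [OF A(1), of "\<lambda>a. a n" p] A_n p by auto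
  have "\<forall>\<^sub>F k in sequentially. 0 < k \<and>
      (\<forall>a\<in>A. dist (mean_norm (average {..<k} x) p (a n)) (?N (a n)) < \<eta> / 2)"
    using A(1) \<eta> by (intro eventually_conj eventually_gt_at_top eventually_ball_finite ballI tendstoD [OF lim]) auto
  then obtain k where k: "0 < k"
    "\<And>a. a \<in> A \<Longrightarrow> dist (mean_norm (average {..<k} x) p (a n)) (?N (a n)) < \<eta> / 2"
    using eventually_happens' [OF sequentially_bot] by blast
  interpret avg: mean G T "average {..<k} x"
    using k(1) x by (intro mean_average) auto
  interpret avg: seminormed ?B "mean_norm (average {..<k} x) p"
    using p by (rule avg.seminormed_mean_norm)
  define P where "P y = mean_norm (average {..<k} x) p (y n)" for y :: "nat \<Rightarrow> 'g \<Rightarrow> 'e"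
  have P: "seminormed (span D) P"
    using X.cauchy_seqs_mem [OF spanY] by unfold_locales (auto simp: P_def avg.scale avg.triangle)
  have "\<bar>P a - lim_norm ?N a\<bar> \<le> \<eta>" if "a \<in> A" for a
    using n [OF that] k(2) [OF that] unfolding P_def dist_real_def by linarith
  then have close: "\<bar>P y - lim_norm ?N y\<bar> \<le> \<delta> * lim_norm ?N y" if "y \<in> span D" for y
    using compare P that by blast
  \<comment> \<open>A class in \<open>F\<close> thus has a unique representative in
    \<open>span D\<close>, and this makes the map \<open>f\<close> below linear although it is
    defined through \<open>inv_into\<close>.\<close>
  have inj: "inj_on C.cls (span D)"
  proof (rule inj_onI)
    fix y z assume "y \<in> span D" "z \<in> span D" "C.cls y = C.cls z"
    then show "y = z"
      using definite [of "y - z"] C.cls_eq_iff [of y z] spanY by (simp add: span_diff)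
  qed
  define s where "s y = step_fun k (\<lambda>j. y n (x j))" for y :: "nat \<Rightarrow> 'g \<Rightarrow> 'e"
  have s_add: "s (y + z) = (\<lambda>t. s y t + s z t)" and s_scale: "s (c *\<^sub>R y) = (\<lambda>t. c *\<^sub>R s y t)" for y z c
    by (simp_all add: s_def step_fun_add step_fun_scale)
  have s_norm: "vnorm ?L (ae_class (s y)) = P y" for y
    using k(1) by (simp add: s_def P_def vnorm_step_fun mean_norm_def average_def)
  define f where "f v = ae_class (s (inv_into (span D) C.cls v))" for v
  have f_cls: "f (C.cls y) = ae_class (s y)" if "y \<in> span D" for y
    using that inj by (simp add: f_def)
  show "\<exists>f. linear_map_on F C.Q ?L f \<and> inj_on f F \<and>
      operator_norm F C.Q ?L f * operator_norm (f ` F) ?L C.Q (inv_into F f) < 1 + \<epsilon>"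
  proof (intro exI conjI)
    show "linear_map_on F C.Q ?L f"
      unfolding linear_map_on_def
    proof (intro conjI ballI allI funcsetI)
      fix v assume "v \<in> F"
      then obtain y where y: "y \<in> span D" "y \<in> ?Y" "v = C.cls y"
        using D(3) spanY by blast
      show "f v \<in> carrier ?L"
        using k(1) by (simp add: f_def s_def step_fun_in_Lp)
      show "f (c \<odot>\<^bsub>C.Q\<^esub> v) = c \<odot>\<^bsub>?L\<^esub> f v" for c
        using y by (simp add: C.smult_Q f_cls span_scale s_scale Lp_smult)
      fix w assume "w \<in> F"
      then obtain z where z: "z \<in> span D" "z \<in> ?Y" "w = C.cls z"
        using D(3) spanY by blast
      show "f (v \<oplus>\<^bsub>C.Q\<^esub> w) = f v \<oplus>\<^bsub>?L\<^esub> f w"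
        using y z by (simp add: C.add_Q f_cls span_add s_add Lp_add)
    qed
    have lower: "(1 - \<delta>) * vnorm C.Q v \<le> vnorm ?L (f v)"
      and upper: "vnorm ?L (f v) \<le> (1 + \<delta>) * vnorm C.Q v" if vF: "v \<in> F" for v
    proof -
      obtain y where y: "y \<in> span D" "y \<in> ?Y" "v = C.cls y"
        using D(3) spanY vF by blast
      show "(1 - \<delta>) * vnorm C.Q v \<le> vnorm ?L (f v)" "vnorm ?L (f v) \<le> (1 + \<delta>) * vnorm C.Q v"
        using close [OF y(1)] y by (auto simp: C.vnorm_Q f_cls s_norm abs_le_iff algebra_simps)
    qed
    show inj_f: "inj_on f F"
    proof (rule inj_onI)
      fix v w assume vw: "v \<in> F" "w \<in> F" "f v = f w"
      then obtain y z where y: "y \<in> span D" "v = C.cls y" and z: "z \<in> span D" "w = C.cls z"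
        using D(3) by blast
      have "AE t in unit_lebesgue. s y t = s z t"
        using vw(3) y z by (simp add: f_cls ae_class_eq_iff)
      \<comment> \<open>Equal images give \<open>P (y - z) = 0\<close> by linearity of
        \<open>s\<close>; as \<open>P\<close> is within the factor \<open>\<delta> < 1\<close> of
        the limit norm, that norm vanishes too.\<close>
      then have "AE t in unit_lebesgue. s (y - z) t = s 0 t"
      proof eventually_elim
        case (elim t)
        then show ?case
          using s_add [of y "(- 1) *\<^sub>R z"] s_scale [of "- 1" z] s_scale [of 0 0] by simp
      qed
      then have "P (y - z) = P 0"
        using s_norm by (metis ae_class_eq_iff)
      also have "P 0 = 0"
        using seminormed.zero [OF P] .
      finally have "lim_norm ?N (y - z) \<le> \<delta> * lim_norm ?N (y - z)"
        using close [of "y - z"] y z by (simp add: span_diff)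
      moreover have "0 \<le> lim_norm ?N (y - z)"
        using y z spanY by (intro C.nonneg) (simp add: span_diff)
      ultimately have "lim_norm ?N (y - z) = 0"
        using \<delta> by (smt (verit) mult_less_cancel_right2)
      then show "v = w"
        using definite [of "y - z"] y z by (simp add: span_diff)
    qed
    have zero: "C.cls 0 \<in> F" "vnorm C.Q (C.cls 0) = 0"
      using D(3) by (auto simp: span_zero C.vnorm_Q)
    have "operator_norm F C.Q ?L f * operator_norm (f ` F) ?L C.Q (inv_into F f)
        \<le> (1 + \<delta>) * (1 / (1 - \<delta>))"
      using \<delta> lower upper inj_f zero by (intro operator_norm_inverse_product_le) auto
    then show "operator_norm F C.Q ?L f * operator_norm (f ` F) ?L C.Q (inv_into F f) < 1 + \<epsilon>"
      using \<delta>\<epsilon> by simp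
  qed
qed

end

section \<open>The affine action on the completion\<close>

locale coarse_mean = mean G T m for G :: "'g monoid" (structure) and T m +
  fixes p :: real and \<sigma> :: "'g \<Rightarrow> 'e::banach"
  assumes p: "1 \<le> p"
    and invariant: "g \<in> carrier G \<Longrightarrow> f \<in> BL \<Longrightarrow> m (\<lambda>x. f (x \<otimes> g)) = m f"
    and uniform: "left_uniformly_continuous G T dist \<sigma>"
    and coarse: "coarse_embedding G T dist \<sigma>"
begin

abbreviation N :: "('g \<Rightarrow> 'e) \<Rightarrow> real" where
  "N \<equiv> mean_norm m p"

abbreviation Y :: "(nat \<Rightarrow> 'g \<Rightarrow> 'e) set" where
  "Y \<equiv> cauchy_seqs BL N"

sublocale X: seminormed "BL :: ('g \<Rightarrow> 'e) set" N
  using p by (rule seminormed_mean_norm)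

sublocale C: seminormed Y "lim_norm N"
  by (rule X.seminormed_completion)

sublocale M: Metric_space "carrier C.Q" "vdist C.Q"
  by (rule C.Metric_space_Q)

lemma lim_norm_le:
  assumes s: "s \<in> Y" and c: "0 \<le> c" "\<And>n x. x \<in> carrier G \<Longrightarrow> norm (s n x) \<le> c"
  shows "lim_norm N s \<le> c"
proof (rule LIMSEQ_le_const2 [OF X.lim_norm [OF s]])
  have "N (s n) \<le> c" for n
    using X.cauchy_seqs_mem [OF s] p c by (intro mean_norm_le) auto
  then show "\<exists>K. \<forall>n\<ge>K. N (s n) \<le> c"
    by blast
qed

text \<open>Identities such as \<open>x \<otimes> \<one> = x\<close> hold on the carrier only, so
  the laws of the representation and of the cocycle are true for classes and not for the functions
  themselves.\<close>

lemma cls_eq_if_eq_on_carrier: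
  assumes "s \<in> Y" "t \<in> Y" "\<And>n x. x \<in> carrier G \<Longrightarrow> s n x = t n x"
  shows "C.cls s = C.cls t"
  using lim_norm_le [of "s - t" 0] C.nonneg [of "s - t"] assms by (simp add: C.cls_eq_iff)

section \<open>The linear part: right translation\<close>

definition translate :: "'g \<Rightarrow> (nat \<Rightarrow> 'g \<Rightarrow> 'e) \<Rightarrow> nat \<Rightarrow> 'g \<Rightarrow> 'e" where
  "translate g s = (\<lambda>n x. s n (x \<otimes> g))"

lemma translate_linear:
  "translate g (s + t) = translate g s + translate g t"
  "translate g (s - t) = translate g s - translate g t"
  "translate g (c *\<^sub>R s) = c *\<^sub>R translate g s"
  by (auto simp: translate_def fun_eq_iff)

lemma N_translate: "N (\<lambda>x. f (x \<otimes> g)) = N f" if "f \<in> BL" "g \<in> carrier G"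
  using invariant [OF that(2) norm_powr_bounded_luc [OF that(1), of p]] p by (simp add: mean_norm_def)

lemma translate_mem: "translate g s \<in> Y" if s: "s \<in> Y" and g: "g \<in> carrier G"
  unfolding cauchy_seqs_def
proof (intro CollectI conjI allI impI)
  show "range (translate g s) \<subseteq> BL"
    using X.cauchy_seqs_mem [OF s] g by (auto simp: translate_def bounded_luc_right_translate)
  have eq: "N (translate g s k - translate g s n) = N (s k - s n)" for k n
    using N_translate [of "s k - s n" g] X.cauchy_seqs_mem [OF s] g
    by (simp add: translate_def fun_diff_def bounded_luc_diff)
  fix e :: real assume "0 < e"
  then show "\<exists>M. \<forall>k\<ge>M. \<forall>n\<ge>M. N (translate g s k - translate g s n) < e"
    unfolding eq using s by (simp add: cauchy_seqs_def)
qed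

lemma lim_norm_translate: "lim_norm N (translate g s) = lim_norm N s" if "s \<in> Y" "g \<in> carrier G"
  unfolding lim_norm_def translate_def using that X.cauchy_seqs_mem by (simp add: N_translate)

definition \<pi> :: "'g \<Rightarrow> (nat \<Rightarrow> 'g \<Rightarrow> 'e) set \<Rightarrow> (nat \<Rightarrow> 'g \<Rightarrow> 'e) set" where
  "\<pi> g A = C.cls (translate g (SOME s. s \<in> A))"

text \<open>Translation preserves the seminorm, by invariance of the mean, and so sends null vectors
  to null vectors.\<close>

lemma \<pi>_cls: "\<pi> g (C.cls s) = C.cls (translate g s)" if s: "s \<in> Y" and g: "g \<in> carrier G"
proof -
  have "lim_norm N (translate g (SOME t. t \<in> C.cls s) - translate g s) = 0"
    using lim_norm_translate [of "(SOME t. t \<in> C.cls s) - s" g] C.rep [OF s] s g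
    by (simp add: translate_linear)
  then show ?thesis
    using C.rep [OF s] s g by (simp add: \<pi>_def C.cls_eq_iff translate_mem)
qed

lemma isometric_representation_\<pi>: "isometric_representation G C.Q \<pi>"
  unfolding isometric_representation_def linear_map_on_def
proof (intro conjI ballI allI funcsetI)
  fix g A assume g: "g \<in> carrier G" and "A \<in> carrier C.Q"
  then obtain s where s: "s \<in> Y" "A = C.cls s"
    using C.Q_cases by blast
  show "\<pi> g A \<in> carrier C.Q" "vnorm C.Q (\<pi> g A) = vnorm C.Q A"
    using s g by (simp_all add: \<pi>_cls translate_mem C.vnorm_Q lim_norm_translate)
  show "\<pi> g (c \<odot>\<^bsub>C.Q\<^esub> A) = c \<odot>\<^bsub>C.Q\<^esub> \<pi> g A" for c
    using s g by (simp add: \<pi>_cls translate_mem C.smult_Q translate_linear)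
  fix B assume "B \<in> carrier C.Q"
  then obtain t where t: "t \<in> Y" "B = C.cls t"
    using C.Q_cases by blast
  show "\<pi> g (A \<oplus>\<^bsub>C.Q\<^esub> B) = \<pi> g A \<oplus>\<^bsub>C.Q\<^esub> \<pi> g B"
    using s t g by (simp add: \<pi>_cls translate_mem C.add_Q translate_linear)
next
  fix A assume "A \<in> carrier C.Q"
  then obtain s where s: "s \<in> Y" "A = C.cls s"
    using C.Q_cases by blast
  then show "\<pi> \<one> A = A"
    by (simp add: \<pi>_cls) (intro cls_eq_if_eq_on_carrier translate_mem; simp add: translate_def)
  fix g f assume "g \<in> carrier G" "f \<in> carrier G"
  then show "\<pi> (g \<otimes> f) A = \<pi> g (\<pi> f A)"
    using s by (simp add: \<pi>_cls translate_mem)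
      (intro cls_eq_if_eq_on_carrier translate_mem; simp add: translate_def m_assoc)
qed

text \<open>The estimate is uniform in \<open>x\<close> because inv (x h) (x g) = inv h g.
  Boundedness of \<open>f\<close> is not assumed, so that \<sigma> itself is covered.\<close>

lemma division_ball:
  assumes g0: "g0 \<in> carrier G" and f: "left_uniformly_continuous G T dist (f :: 'g \<Rightarrow> 'e)" and e: "0 < e"
  obtains U where "openin T U" "g0 \<in> U"
    "\<And>g x. g \<in> U \<Longrightarrow> x \<in> carrier G \<Longrightarrow> norm (f (x \<otimes> g0) - f (x \<otimes> g)) \<le> e"
proof -
  obtain W where W: "openin T W" "\<one> \<in> W"
    "\<And>x y. x \<in> carrier G \<Longrightarrow> y \<in> carrier G \<Longrightarrow> inv x \<otimes> y \<in> W \<Longrightarrow> dist (f x) (f y) < e"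
    using f e by (rule left_uniformly_continuousE) blast
  show thesis
  proof (rule that)
    show "openin T {g \<in> carrier G. inv g0 \<otimes> g \<in> W}"
      using W(1) g0 by (intro open_preimage continuous_group_intros) auto
    show "g0 \<in> {g \<in> carrier G. inv g0 \<otimes> g \<in> W}"
      using W(2) g0 by simp
    fix g x assume "g \<in> {g \<in> carrier G. inv g0 \<otimes> g \<in> W}" "x \<in> carrier G"
    then show "norm (f (x \<otimes> g0) - f (x \<otimes> g)) \<le> e"
      using W(3) [of "x \<otimes> g0" "x \<otimes> g"] g0
      by (simp add: inv_mult_group m_assoc dist_norm less_imp_le)
  qed
qed

text \<open>The terms of a Cauchy sequence have no evident common modulus of continuity, but a
  single term has one. Replacing \<open>s\<close> by a constant sequence costs \<open>e / 4\<close>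
  before and after translation, as \<open>\<pi>\<close> is isometric.\<close>

lemma strongly_continuous_\<pi>: "strongly_continuous T C.Q \<pi>"
  unfolding strongly_continuous_def norm_topology_def M.continuous_map_to_metric
proof (intro ballI allI impI)
  fix A g0 and e :: real
  assume "A \<in> carrier C.Q" and "g0 \<in> topspace T" and e: "0 < e"
  then obtain s where s: "s \<in> Y" "A = C.cls s" and g0: "g0 \<in> carrier G"
    using C.Q_cases by auto
  have e4: "0 < e / 4"
    using e by simp
  obtain n where n: "lim_norm N (s - (\<lambda>_. s n)) < e / 4"
    using eventually_happens' [OF sequentially_bot X.const_dense [OF s(1) e4]] by blast
  define c where "c = (\<lambda>_::nat. s n)"
  have c: "c \<in> Y"
    unfolding c_def using X.cauchy_seqs_mem [OF s(1)] by simp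
  have "left_uniformly_continuous G T dist (s n)"
    using X.cauchy_seqs_mem [OF s(1), of n] by (simp add: bounded_luc_def)
  then obtain U where U: "openin T U" "g0 \<in> U"
    "\<And>g x. g \<in> U \<Longrightarrow> x \<in> carrier G \<Longrightarrow> norm (s n (x \<otimes> g0) - s n (x \<otimes> g)) \<le> e / 4"
    using division_ball [OF g0 _ e4] by blast
  show "\<exists>U. openin T U \<and> g0 \<in> U \<and> (\<forall>g\<in>U. \<pi> g A \<in> M.mball (\<pi> g0 A) e)"
  proof (intro exI conjI ballI)
    fix g assume gU: "g \<in> U"
    then have g: "g \<in> carrier G"
      using open_subset U(1) by blast
    note Y = translate_mem [OF s(1) g0] translate_mem [OF c g0] translate_mem [OF s(1) g] translate_mem [OF c g]
    have "lim_norm N (translate g0 s - translate g0 c) = lim_norm N (s - c)"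
      using lim_norm_translate [of "s - c" g0] s c g0 by (simp add: translate_linear)
    moreover have "lim_norm N (translate g c - translate g s) = lim_norm N (s - c)"
      using lim_norm_translate [of "c - s" g] C.minus_commute [OF c s(1)] s c g by (simp add: translate_linear)
    moreover have "lim_norm N (translate g0 c - translate g c) \<le> e / 4"
    proof (rule lim_norm_le)
      show "translate g0 c - translate g c \<in> Y"
        using Y by simp
      show "norm ((translate g0 c - translate g c) k x) \<le> e / 4" if "x \<in> carrier G" for k x
        using U(3) [OF gU that] by (simp add: translate_def c_def)
    qed (use e in simp)
    ultimately have "lim_norm N (translate g0 s - translate g s) < e"
      using C.triangle_via [OF Y(1,2,3)] C.triangle_via [OF Y(2,4,3)] n e unfolding c_def by linarith
    then show "\<pi> g A \<in> M.mball (\<pi> g0 A) e"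
      using Y s g g0 by (simp add: \<pi>_cls C.vdist_Q)
  qed (use U in auto)
qed

section \<open>The cocycle and its large-scale geometry\<close>

lemma left_coarse_translates:
  assumes A: "A \<in> left_coarse G T"
  shows "(\<lambda>(x, g, f). (x \<otimes> g, x \<otimes> f)) ` (carrier G \<times> A) \<in> left_coarse G T"
  unfolding left_coarse_def
proof (intro CollectI conjI allI impI)
  have AG: "A \<subseteq> carrier G \<times> carrier G"
    using A by (simp add: left_coarse_def)
  then show "(\<lambda>(x, g, f). (x \<otimes> g, x \<otimes> f)) ` (carrier G \<times> A) \<subseteq> carrier G \<times> carrier G"
    by auto
  fix d assume d: "continuous_left_invariant_ecart G T d"
  then have "bdd_above ((\<lambda>(x, y). d x y) ` A)"
    using A by (simp add: left_coarse_def)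
  moreover have "d (x \<otimes> g) (x \<otimes> f) = d g f" if "x \<in> carrier G" "(g, f) \<in> A" for x g f
    using d that AG by (auto simp: continuous_left_invariant_ecart_def)
  then have "(\<lambda>(x, y). d x y) ` (\<lambda>(x, g, f). (x \<otimes> g, x \<otimes> f)) ` (carrier G \<times> A) \<subseteq> (\<lambda>(x, y). d x y) ` A"
    by force
  ultimately show "bdd_above ((\<lambda>(x, y). d x y) ` (\<lambda>(x, g, f). (x \<otimes> g, x \<otimes> f)) ` (carrier G \<times> A))"
    by (rule bdd_above_mono)
qed

text \<open>Left-invariant ecarts take no new values on left translates of \<open>A\<close>, so
  \<sigma> may be tested on all translates at once, giving one bound for every
  \<open>x\<close>.\<close>

lemma bornologous_uniform_bound:
  assumes A: "A \<in> left_coarse G T"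
  obtains c where "0 \<le> c"
    "\<forall>x\<in>carrier G. \<forall>(g, f)\<in>A. dist (\<sigma> (x \<otimes> g)) (\<sigma> (x \<otimes> f)) \<le> c"
proof -
  have "bdd_above ((\<lambda>(x, y). dist (\<sigma> x) (\<sigma> y)) ` (\<lambda>(x, g, f). (x \<otimes> g, x \<otimes> f)) ` (carrier G \<times> A))"
    using coarse left_coarse_translates [OF A] by (simp add: coarse_embedding_def bornologous_def)
  then obtain c where "\<forall>x\<in>carrier G. \<forall>(g, f)\<in>A. dist (\<sigma> (x \<otimes> g)) (\<sigma> (x \<otimes> f)) \<le> c"
    unfolding bdd_above_def by fastforce
  then show thesis
    by (intro that [of "max 0 c"]) (auto simp: le_max_iff_disj)
qed

text \<open>Formally the coboundary of \<sigma> under right translation; \<sigma> itself need not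
  belong to \<open>BL\<close>.\<close>

definition displacement :: "'g \<Rightarrow> 'g \<Rightarrow> 'e" where
  "displacement g = (\<lambda>x. \<sigma> (x \<otimes> g) - \<sigma> x)"

lemma displacement_diff: "(displacement g - displacement f) x = \<sigma> (x \<otimes> g) - \<sigma> (x \<otimes> f)"
  by (simp add: displacement_def)

text \<open>A single pair is always coarsely bounded, so the uniform bound for
  \<open>{(g, \<one>)}\<close> is a bound for the displacement by \<open>g\<close>.\<close>

lemma displacement_mem: "displacement g \<in> BL" if g: "g \<in> carrier G"
proof -
  have "{(g, \<one>)} \<in> left_coarse G T"
    using g by (simp add: left_coarse_def)
  then obtain c where "\<forall>x\<in>carrier G. \<forall>(g, f)\<in>{(g, \<one>)}. dist (\<sigma> (x \<otimes> g)) (\<sigma> (x \<otimes> f)) \<le> c"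
    by (rule bornologous_uniform_bound)
  then have "bounded (displacement g ` carrier G)"
    by (auto simp: bounded_iff displacement_def dist_norm)
  moreover have "left_uniformly_continuous G T dist (\<lambda>x. \<sigma> (x \<otimes> g) + (- 1) *\<^sub>R \<sigma> x)"
    using uniform g
    by (intro left_uniformly_continuous_add left_uniformly_continuous_scale left_uniformly_continuous_right_translate)
  ultimately show ?thesis
    by (simp add: bounded_luc_def displacement_def)
qed

definition b :: "'g \<Rightarrow> (nat \<Rightarrow> 'g \<Rightarrow> 'e) set" where
  "b g = C.cls (\<lambda>_. displacement g)"

lemma b_mem: "g \<in> carrier G \<Longrightarrow> b g \<in> carrier C.Q"
  by (simp add: b_def displacement_mem)

lemma vdist_b: "vdist C.Q (b g) (b f) = N (displacement g - displacement f)"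
  if "g \<in> carrier G" "f \<in> carrier G"
proof -
  have "(\<lambda>_::nat. displacement g) - (\<lambda>_. displacement f) = (\<lambda>_. displacement g - displacement f)"
    by (rule ext) simp
  then show ?thesis
    using that by (simp add: b_def C.vdist_Q displacement_mem)
qed

lemma vdist_b_le:
  assumes "g \<in> carrier G" "f \<in> carrier G" "0 \<le> c"
    and "\<And>x. x \<in> carrier G \<Longrightarrow> norm (\<sigma> (x \<otimes> g) - \<sigma> (x \<otimes> f)) \<le> c"
  shows "vdist C.Q (b g) (b f) \<le> c"
  unfolding vdist_b [OF assms(1,2)]
  using assms p by (intro mean_norm_le X.mem displacement_mem) (auto simp: displacement_def)

text \<open>The sum telescopes: the translate by \<open>g\<close> of \<open>displacement f\<close>
  takes the value \<sigma>(x g f) - \<sigma>(x g) at x.\<close>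

lemma cocycle_b: "cocycle G C.Q \<pi> b"
  unfolding cocycle_def
proof (intro conjI ballI funcsetI)
  fix g f assume g: "g \<in> carrier G" and f: "f \<in> carrier G"
  have "C.cls (\<lambda>_. displacement (g \<otimes> f)) =
      C.cls (translate g (\<lambda>_. displacement f) + (\<lambda>_. displacement g))"
  proof (rule cls_eq_if_eq_on_carrier)
    show "(\<lambda>_. displacement (g \<otimes> f)) \<in> Y"
      "translate g (\<lambda>_. displacement f) + (\<lambda>_. displacement g) \<in> Y"
      using g f by (simp_all add: displacement_mem translate_mem)
  qed (use g f in \<open>simp add: translate_def displacement_def m_assoc\<close>)
  then show "b (g \<otimes> f) = \<pi> g (b f) \<oplus>\<^bsub>C.Q\<^esub> b g"
    using g f by (simp add: b_def \<pi>_cls C.add_Q translate_mem displacement_mem)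
qed (rule b_mem)

lemma continuous_b: "continuous_map T (norm_topology C.Q) b"
  unfolding norm_topology_def M.continuous_map_to_metric
proof (intro ballI allI impI)
  fix g0 and e :: real
  assume "g0 \<in> topspace T" and e: "0 < e"
  then have g0: "g0 \<in> carrier G" and e2: "0 < e / 2"
    by simp_all
  obtain U where U: "openin T U" "g0 \<in> U"
    "\<And>g x. g \<in> U \<Longrightarrow> x \<in> carrier G \<Longrightarrow> norm (\<sigma> (x \<otimes> g0) - \<sigma> (x \<otimes> g)) \<le> e / 2"
    using division_ball [OF g0 uniform e2] by blast
  show "\<exists>U. openin T U \<and> g0 \<in> U \<and> (\<forall>g\<in>U. b g \<in> M.mball (b g0) e)"
  proof (intro exI conjI ballI)
    fix g assume gU: "g \<in> U"
    then have g: "g \<in> carrier G"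
      using open_subset U(1) by blast
    have "vdist C.Q (b g0) (b g) \<le> e / 2"
      using g0 g e U(3) [OF gU] by (intro vdist_b_le) auto
    then show "b g \<in> M.mball (b g0) e"
      using g g0 e by (simp add: b_mem)
  qed (use U in auto)
qed

lemma bornologous_b: "bornologous G T (vdist C.Q) b"
  unfolding bornologous_def
proof
  fix A assume A: "A \<in> left_coarse G T"
  then have AG: "A \<subseteq> carrier G \<times> carrier G"
    by (simp add: left_coarse_def)
  obtain c where c: "0 \<le> c" "\<forall>x\<in>carrier G. \<forall>(g, f)\<in>A. dist (\<sigma> (x \<otimes> g)) (\<sigma> (x \<otimes> f)) \<le> c"
    using A by (rule bornologous_uniform_bound)
  have "vdist C.Q (b g) (b f) \<le> c" if "(g, f) \<in> A" for g f
    using that c AG by (intro vdist_b_le) (auto simp: dist_norm)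
  then show "bdd_above ((\<lambda>(x, y). vdist C.Q (b x) (b y)) ` A)"
    by (intro bdd_aboveI2 [of _ _ c]) auto
qed

text \<open>A small mean forces a small value: at some \<open>x\<close> the points \<sigma>(x g) and
  \<sigma>(x f) are close. Expansion of \<sigma> then bounds d(x g, x f), which is d(g, f) by left
  invariance.\<close>

lemma expanding_b: "expanding G T (vdist C.Q) b"
  unfolding expanding_def
proof
  fix c
  \<comment> \<open>The slack 1 turns the bound \<open>c\<close> into the strict inequality that
    \<open>ex_norm_less\<close> requires.\<close>
  define E where "E = {(x, y). x \<in> carrier G \<and> y \<in> carrier G \<and> dist (\<sigma> x) (\<sigma> y) \<le> c + 1}"
  have E: "E \<in> left_coarse G T"
    using coarse by (simp add: E_def coarse_embedding_def expanding_def)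
  show "{(g, f). g \<in> carrier G \<and> f \<in> carrier G \<and> vdist C.Q (b g) (b f) \<le> c} \<in> left_coarse G T"
    unfolding left_coarse_def
  proof (intro CollectI conjI allI impI)
    fix d assume d: "continuous_left_invariant_ecart G T d"
    then have "bdd_above ((\<lambda>(x, y). d x y) ` E)"
      using E by (simp add: left_coarse_def)
    then obtain K where K: "\<And>x y. (x, y) \<in> E \<Longrightarrow> d x y \<le> K"
      unfolding bdd_above_def by fastforce
    have "d g f \<le> K" if "g \<in> carrier G" "f \<in> carrier G" "vdist C.Q (b g) (b f) \<le> c" for g f
    proof -
      have "N (displacement g - displacement f) < c + 1"
        using that by (simp add: vdist_b)
      moreover have "displacement g - displacement f \<in> BL" "0 < p"
        using that p by (simp_all add: displacement_mem)
      ultimately obtain x where x: "x \<in> carrier G" "norm ((displacement g - displacement f) x) < c + 1"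
        using ex_norm_less by blast
      then have "d (x \<otimes> g) (x \<otimes> f) \<le> K"
        using that by (intro K) (auto simp: E_def dist_norm displacement_diff simp del: minus_apply)
      then show ?thesis
        using d x that by (auto simp: continuous_left_invariant_ecart_def)
    qed
    then show "bdd_above ((\<lambda>(x, y). d x y) `
        {(g, f). g \<in> carrier G \<and> f \<in> carrier G \<and> vdist C.Q (b g) (b f) \<le> c})"
      by (intro bdd_aboveI2 [of _ _ K]) auto
  qed auto
qed

lemma ex_action:
  "\<exists>(V :: (nat \<Rightarrow> 'g \<Rightarrow> 'e) set normed_module) \<alpha> \<pi> b.
    banach_space V \<and> continuous_affine_isometric_action G T V \<alpha> \<pi> b \<and>
    coarsely_proper G T V b \<and> finitely_representable V (Lp p :: (real \<Rightarrow> 'e) set normed_module)"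
proof (intro exI conjI)
  show "banach_space C.Q"
    by (rule X.banach_space_completion)
  show "continuous_affine_isometric_action G T C.Q (\<lambda>g \<xi>. \<pi> g \<xi> \<oplus>\<^bsub>C.Q\<^esub> b g) \<pi> b"
    by (simp add: continuous_affine_isometric_action_def isometric_representation_\<pi>
        strongly_continuous_\<pi> cocycle_b continuous_b)
  show "coarsely_proper G T C.Q b"
    by (simp add: coarsely_proper_def coarse_embedding_def bornologous_b expanding_b)
  show "finitely_representable C.Q (Lp p :: (real \<Rightarrow> 'e) set normed_module)"
    using p by (rule finitely_representable_completion)
qed

end

theorem theorem7:
  fixes G :: "'g monoid" and T :: "'g topology"
    and \<sigma> :: "'g \<Rightarrow> 'e::banach" and p :: real
  assumes "polish_group G T"
    and "folner_amenable TYPE('h) G T"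
    and "left_uniformly_continuous G T dist \<sigma>"
    and "coarse_embedding G T dist \<sigma>"
    and "1 \<le> p"
  shows "\<exists>(V :: (nat \<Rightarrow> 'g \<Rightarrow> 'e) set normed_module) \<alpha> \<pi> b.
           banach_space V \<and>
           continuous_affine_isometric_action G T V \<alpha> \<pi> b \<and>
           coarsely_proper G T V b \<and>
           finitely_representable V (Lp p :: (real \<Rightarrow> 'e) set normed_module)"
proof -
  interpret top_group G T
    using assms(1)
    by (simp add: polish_group_def top_group_def top_group_axioms_def topological_group_def)
  obtain m where m: "mean G T m"
    and invariant: "\<forall>g\<in>carrier G. \<forall>f\<in>BL. m (\<lambda>x. f (x \<otimes>\<^bsub>G\<^esub> g)) = m f"
    using ex_invariant_mean [OF _ assms(2)] assms(1) unfolding polish_group_def by blast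
  interpret coarse_mean G T m p \<sigma>
    using m invariant assms(3-5) by (intro coarse_mean.intro coarse_mean_axioms.intro) auto
  show ?thesis
    by (rule ex_action)
qed

end
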